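(* Let $\theta>0$ and assume $\det\gamma_k\ne0$ for all $k\ge1$. Assume that the block operators $\mathsf A,\mathsf B,\mathsf C,\mathcal H_\theta$ below define bounded operators between the corresponding $\ell^2$-direct sums, that $sI-\mathsf A$ is boundedly invertible for all $\mathrm{Re}\,s\ge0$, and that there is a bounded self-adjoint operator $\mathsf Q_\theta$ on $\mathcal X:=\bigoplus_{k\ge0}\mathbb C^N$ solving the Riccati equation $$\mathsf A^T\mathsf Q_\theta+\mathsf Q_\theta\mathsf A+\theta\,\mathsf C^T\mathcal H_\theta\mathsf C+\mathsf L_\theta^*\mathsf L_\theta=0,\qquad \mathsf L_\theta:=\mathsf B^*\mathsf Q_\theta,$$ which is stabilizing in the sense that the spectrum of $\mathsf A+\mathsf B\mathsf L_\theta$ lies in the open left half-plane. Then the transfer function $\mathcal G_\theta(s):=I_m+\mathsf L_\theta(sI-\mathsf A-\mathsf B\mathsf L_\theta)^{-1}\mathsf B$ satisfies $\mathcal G_\theta(i\lambda)$ invertible and $$\Delta_\theta(\lambda)^{-1}=\mathcal G_\theta(i\lambda)\mathcal G_\theta(i\lambda)^*\qquad\text{for all }\lambda\in\mathbb R .$$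
   Context: Let $m,N$ be even, $\mathbf J=\begin{bmatrix}0&1\\-1&0\end{bmatrix}$, $J:=I_{m/2}\otimes\mathbf J$, $\Omega:=I_m+iJ$, $S:=\Omega^T/\sqrt2$. Let $\Theta\in\mathbb R^{N\times N}$ be antisymmetric and nonsingular, $\mathcal A\in\mathbb R^{N\times N}$ Hurwitz, $\mathcal B\in\mathbb R^{N\times m}$, $\mathcal C\in\mathbb R^{r\times N}$ with $\mathcal A\Theta+\Theta\mathcal A^T+\mho=0$, where $\mho:=\mathcal BJ\mathcal B^T$; $\Pi:=\mathcal C^T\mathcal C$; $G(s):=(sI_N-\mathcal A)^{-1}$, $F(s):=\mathcal CG(s)\mathcal B$, $\Psi(\lambda):=F(i\lambda)JF(i\lambda)^*$; $(\cdot)^*$ is adjoint/conjugate transpose. $\phi(u):=(e^u-1)/u=\sum_{k\ge0}\phi_ku^k$, $\phi_k=1/(k+1)!$, applied to matrices via the series; $\Sigma_\theta(\lambda):=SF(i\lambda)^*\phi(2i\theta\Psi(\lambda))F(i\lambda)S$, $\Delta_\theta:=I_m-\theta\Sigma_\theta$. For a matrix $U$, $\mathbf L_{\mathcal A}(U):=\int_0^\infty e^{t\mathcal A}Ue^{t\mathcal A^T}dt$. Recursion: $\alpha_1=\gamma_0=\Theta$, $\beta_0=I_N$, $\beta_1=\Theta^{-1}\mho\Theta^{-1}$, and for $k\ge1$: $\gamma_k=\mathbf L_{\mathcal A}(\alpha_k\Pi^{\delta_{k1}}\gamma_{k-1})$, $\alpha_{k+1}=\gamma_k\beta_k$, $\beta_{k+1}=\gamma_k^{-1}\alpha_k\Pi^{\delta_{k1}}\gamma_{k-1}\gamma_k^{-1}$,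 where $\Pi^{\delta_{k1}}$ equals $\Pi$ if $k=1$ and $I_N$ otherwise. $\mathcal H_\theta:=\mathrm{diag}\big(I_r,\mathrm{diag}_{k\ge1}((-2i\theta)^k\phi_k\beta_k)\big)$ acting on $\mathbb C^r\oplus\bigoplus_{k\ge1}\mathbb C^N$. Infinite state-space matrices: $\mathsf A$ is block lower bidiagonal on $\mathcal X=\bigoplus_{k\ge0}\mathbb C^N$ with diagonal blocks $\mathcal A$ and subdiagonal blocks $\alpha_1\Pi,\alpha_2,\alpha_3,\dots$ (i.e. $(\mathsf Ax)_0=\mathcal Ax_0$, $(\mathsf Ax)_1=\alpha_1\Pi x_0+\mathcal Ax_1$, $(\mathsf Ax)_k=\alpha_kx_{k-1}+\mathcal Ax_k$ for $k\ge2$); $\mathsf B:\mathbb C^m\to\mathcal X$, $\mathsf Bv=(\mathcal BSv,0,0,\dots)$; $\mathsf C:\mathcal X\to\mathbb C^r\oplus\bigoplus_{k\ge1}\mathbb C^N$, $\mathsf Cx=(\mathcal Cx_0,x_1,x_2,\dots)$. (Then $\mathsf C(sI-\mathsf A)^{-1}\mathsf B=\mathcal F(s)F(s)S$ with $\mathcal F=(I_r,G_1,G_2,\dots)$, $G_k(s)=G(s)\alpha_k\cdots G(s)\alpha_1\mathcal C^T$.) *)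

theory Defs
  imports "HOL-Analysis.Analysis"
begin

text \<open>Index types: 'n has N elements (state dimension), 'r has r elements,
  and the input dimension m is encoded by the index type 'k \<times> 2, so that
  m = 2 * CARD('k) is even and J = I_{m/2} (Kronecker) bold J, where the
  index (a,b) corresponds to position 2a+b.\<close>

primrec mpow :: "'a::semiring_1^'n^'n \<Rightarrow> nat \<Rightarrow> 'a^'n^'n" where
  "mpow M 0 = mat 1"
| "mpow M (Suc k) = M ** mpow M k"

definition cm :: "real^'c^'r \<Rightarrow> complex^'c^'r" where
  "cm M = (\<chi> i j. complex_of_real (M $ i $ j))"

definition cadj :: "complex^'c^'r \<Rightarrow> complex^'r^'c" where
  "cadj M = (\<chi> i j. cnj (M $ j $ i))"

definition csmul :: "complex \<Rightarrow> complex^'c^'r \<Rightarrow> complex^'c^'r" where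
  "csmul c M = (\<chi> i j. c * M $ i $ j)"

definition cinner :: "complex^'n \<Rightarrow> complex^'n \<Rightarrow> complex" where
  "cinner u v = (\<Sum>i\<in>UNIV. u $ i * cnj (v $ i))"

definition Jbold :: "real^2^2" where
  "Jbold = (\<chi> i j. if i = 0 \<and> j = 1 then 1 else if i = 1 \<and> j = 0 then -1 else 0)"

definition Jm :: "real^('k::finite \<times> 2)^('k::finite \<times> 2)" where
  "Jm = (\<chi> p q. if fst p = fst q then Jbold $ snd p $ snd q else 0)"

definition Omega :: "complex^('k::finite \<times> 2)^('k::finite \<times> 2)" where
  "Omega = mat 1 + csmul \<i> (cm Jm)"

definition Smat :: "complex^('k::finite \<times> 2)^('k::finite \<times> 2)" where
  "Smat = (1 / sqrt 2) *\<^sub>R transpose Omega"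

definition mexp :: "real^'n^'n \<Rightarrow> real^'n^'n" where
  "mexp M = (\<Sum>k. (1 / fact k) *\<^sub>R mpow M k)"

definition hurwitz :: "real^'n^'n \<Rightarrow> bool" where
  "hurwitz M \<longleftrightarrow> (\<forall>(z::complex) v. v \<noteq> 0 \<and> cm M *v v = z *s v \<longrightarrow> Re z < 0)"

definition LA :: "real^'n^'n \<Rightarrow> real^'n^'n \<Rightarrow> real^'n^'n" where
  "LA M U = integral {0..} (\<lambda>t::real. mexp (t *\<^sub>R M) ** U ** mexp (t *\<^sub>R transpose M))"

definition mho :: "real^('k::finite \<times> 2)^'n \<Rightarrow> real^'n^'n" where
  "mho B = B ** Jm ** transpose B"

definition PiC :: "real^'n^'r \<Rightarrow> real^'n^'n" where
  "PiC C = transpose C ** C"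

text \<open>The recursion. abg A Th B C j = (alpha_{j+1}, beta_{j+1}, gamma_j).\<close>

definition abg_step :: "real^'n^'n \<Rightarrow> real^'n^'r \<Rightarrow> nat \<Rightarrow>
    (real^'n^'n) \<times> (real^'n^'n) \<times> (real^'n^'n) \<Rightarrow> (real^'n^'n) \<times> (real^'n^'n) \<times> (real^'n^'n)" where
  "abg_step A C k t =
     (let a = fst t; b = fst (snd t); g = snd (snd t);
          P = (if k = 1 then PiC C else mat 1);
          gk = LA A (a ** P ** g)
      in (gk ** b, matrix_inv gk ** a ** P ** g ** matrix_inv gk, gk))"

primrec abg :: "real^'n^'n \<Rightarrow> real^'n^'n \<Rightarrow> real^('k::finite \<times> 2)^'n \<Rightarrow> real^'n^'r \<Rightarrow> nat \<Rightarrow>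
    (real^'n^'n) \<times> (real^'n^'n) \<times> (real^'n^'n)" where
  "abg A Th B C 0 = (Th, matrix_inv Th ** mho B ** matrix_inv Th, Th)"
| "abg A Th B C (Suc j) = abg_step A C (Suc j) (abg A Th B C j)"

definition alpha :: "real^'n^'n \<Rightarrow> real^'n^'n \<Rightarrow> real^('k::finite \<times> 2)^'n \<Rightarrow> real^'n^'r \<Rightarrow> nat \<Rightarrow> real^'n^'n" where
  "alpha A Th B C k = fst (abg A Th B C (k - 1))"   \<comment> \<open>meaningful for k \<ge> 1\<close>

definition beta :: "real^'n^'n \<Rightarrow> real^'n^'n \<Rightarrow> real^('k::finite \<times> 2)^'n \<Rightarrow> real^'n^'r \<Rightarrow> nat \<Rightarrow> real^'n^'n" where
  "beta A Th B C k = (if k = 0 then mat 1 else fst (snd (abg A Th B C (k - 1))))"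

definition gamma :: "real^'n^'n \<Rightarrow> real^'n^'n \<Rightarrow> real^('k::finite \<times> 2)^'n \<Rightarrow> real^'n^'r \<Rightarrow> nat \<Rightarrow> real^'n^'n" where
  "gamma A Th B C k = snd (snd (abg A Th B C k))"

definition Ffun :: "real^'n^'n \<Rightarrow> real^('k::finite \<times> 2)^'n \<Rightarrow> real^'n^'r \<Rightarrow> complex \<Rightarrow> complex^('k::finite \<times> 2)^'r" where
  "Ffun A B C s = cm C ** matrix_inv (mat s - cm A) ** cm B"

definition Psi :: "real^'n^'n \<Rightarrow> real^('k::finite \<times> 2)^'n \<Rightarrow> real^'n^'r \<Rightarrow> real \<Rightarrow> complex^'r^'r" where
  "Psi A B C lam = Ffun A B C (\<i> * lam) ** cm Jm ** cadj (Ffun A B C (\<i> * lam))"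

definition phi_mat :: "complex^'r^'r \<Rightarrow> complex^'r^'r" where
  "phi_mat M = (\<Sum>k. (1 / fact (k + 1)) *\<^sub>R mpow M k)"

definition Sigma :: "real^'n^'n \<Rightarrow> real^('k::finite \<times> 2)^'n \<Rightarrow> real^'n^'r \<Rightarrow> real \<Rightarrow> real \<Rightarrow> complex^('k::finite \<times> 2)^('k::finite \<times> 2)" where
  "Sigma A B C th lam =
     Smat ** cadj (Ffun A B C (\<i> * lam)) ** phi_mat (csmul (2 * \<i> * th) (Psi A B C lam))
       ** Ffun A B C (\<i> * lam) ** Smat"

definition Delta :: "real^'n^'n \<Rightarrow> real^('k::finite \<times> 2)^'n \<Rightarrow> real^'n^'r \<Rightarrow> real \<Rightarrow> real \<Rightarrow> complex^('k::finite \<times> 2)^('k::finite \<times> 2)" where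
  "Delta A B C th lam = mat 1 - th *\<^sub>R Sigma A B C th lam"

text \<open>X = l2-direct sum of copies of C^N indexed by k \<ge> 0; the output space
  C^r \<oplus> (l2-direct sum over k \<ge> 1 of C^N) is represented by pairs (y0, y)
  with y j the component of index k = j + 1.\<close>

definition l2X :: "(nat \<Rightarrow> complex^'n) set" where
  "l2X = {x. summable (\<lambda>k. (norm (x k))\<^sup>2)}"

definition l2norm :: "(nat \<Rightarrow> complex^'n) \<Rightarrow> real" where
  "l2norm x = sqrt (\<Sum>k. (norm (x k))\<^sup>2)"

definition l2inner :: "(nat \<Rightarrow> complex^'n) \<Rightarrow> (nat \<Rightarrow> complex^'n) \<Rightarrow> complex" where
  "l2inner x y = (\<Sum>k. cinner (x k) (y k))"

definition l2Y :: "((complex^'r) \<times> (nat \<Rightarrow> complex^'n)) set" where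
  "l2Y = {y. snd y \<in> l2X}"

definition l2Ynorm :: "(complex^'r) \<times> (nat \<Rightarrow> complex^'n) \<Rightarrow> real" where
  "l2Ynorm y = sqrt ((norm (fst y))\<^sup>2 + (l2norm (snd y))\<^sup>2)"

definition bounded_op :: "'a set \<Rightarrow> ('a \<Rightarrow> real) \<Rightarrow> 'b set \<Rightarrow> ('b \<Rightarrow> real) \<Rightarrow> ('a \<Rightarrow> 'b) \<Rightarrow> bool" where
  "bounded_op D nD E nE T \<longleftrightarrow> T ` D \<subseteq> E \<and> (\<exists>K. \<forall>x\<in>D. nE (T x) \<le> K * nD x)"

definition bdd_invertible :: "((nat \<Rightarrow> complex^'n) \<Rightarrow> (nat \<Rightarrow> complex^'n)) \<Rightarrow> bool" where
  "bdd_invertible T \<longleftrightarrow> bij_betw T l2X l2X \<and>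
     (\<exists>K. \<forall>y\<in>l2X. l2norm (inv_into l2X T y) \<le> K * l2norm y)"

definition shiftI :: "complex \<Rightarrow> ((nat \<Rightarrow> complex^'n) \<Rightarrow> (nat \<Rightarrow> complex^'n)) \<Rightarrow>
    (nat \<Rightarrow> complex^'n) \<Rightarrow> (nat \<Rightarrow> complex^'n)" where
  "shiftI s T x = (\<lambda>k. s *s x k - T x k)"

definition spectrum_l2 :: "((nat \<Rightarrow> complex^'n) \<Rightarrow> (nat \<Rightarrow> complex^'n)) \<Rightarrow> complex set" where
  "spectrum_l2 T = {s. \<not> bdd_invertible (shiftI s T)}"

definition bdd_selfadjoint :: "((nat \<Rightarrow> complex^'n) \<Rightarrow> (nat \<Rightarrow> complex^'n)) \<Rightarrow> bool" where
  "bdd_selfadjoint Q \<longleftrightarrow> bounded_op l2X l2norm l2X l2norm Q \<and>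
     (\<forall>x\<in>l2X. \<forall>y\<in>l2X. Q (\<lambda>k. x k + y k) = (\<lambda>k. Q x k + Q y k)) \<and>
     (\<forall>x\<in>l2X. \<forall>c. Q (\<lambda>k. c *s x k) = (\<lambda>k. c *s Q x k)) \<and>
     (\<forall>x\<in>l2X. \<forall>y\<in>l2X. l2inner (Q x) y = l2inner x (Q y))"

definition ladj :: "((nat \<Rightarrow> complex^'n) \<Rightarrow> complex^'m) \<Rightarrow> complex^'m \<Rightarrow> (nat \<Rightarrow> complex^'n)" where
  "ladj L v = (THE x. x \<in> l2X \<and> (\<forall>y\<in>l2X. cinner (L y) v = l2inner y x))"

definition opA :: "real^'n^'n \<Rightarrow> real^'n^'n \<Rightarrow> real^('k::finite \<times> 2)^'n \<Rightarrow> real^'n^'r \<Rightarrow>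
    (nat \<Rightarrow> complex^'n) \<Rightarrow> (nat \<Rightarrow> complex^'n)" where
  "opA A Th B C x = (\<lambda>k.
     if k = 0 then cm A *v x 0
     else if k = 1 then cm (alpha A Th B C 1 ** PiC C) *v x 0 + cm A *v x 1
     else cm (alpha A Th B C k) *v x (k - 1) + cm A *v x k)"

definition opAT :: "real^'n^'n \<Rightarrow> real^'n^'n \<Rightarrow> real^('k::finite \<times> 2)^'n \<Rightarrow> real^'n^'r \<Rightarrow>
    (nat \<Rightarrow> complex^'n) \<Rightarrow> (nat \<Rightarrow> complex^'n)" where
  "opAT A Th B C x = (\<lambda>k.
     if k = 0 then cm (transpose A) *v x 0 + cm (transpose (alpha A Th B C 1 ** PiC C)) *v x 1
     else cm (transpose A) *v x k + cm (transpose (alpha A Th B C (k + 1))) *v x (k + 1))"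

definition opB :: "real^('k::finite \<times> 2)^'n \<Rightarrow> complex^('k::finite \<times> 2) \<Rightarrow> (nat \<Rightarrow> complex^'n)" where
  "opB B v = (\<lambda>k. if k = 0 then (cm B ** Smat) *v v else 0)"

definition opBadj :: "real^('k::finite \<times> 2)^'n \<Rightarrow> (nat \<Rightarrow> complex^'n) \<Rightarrow> complex^('k::finite \<times> 2)" where
  "opBadj B x = cadj (cm B ** Smat) *v x 0"

definition opC :: "real^'n^'r \<Rightarrow> (nat \<Rightarrow> complex^'n) \<Rightarrow> (complex^'r) \<times> (nat \<Rightarrow> complex^'n)" where
  "opC C x = (cm C *v x 0, \<lambda>j. x (Suc j))"

definition opCT :: "real^'n^'r \<Rightarrow> (complex^'r) \<times> (nat \<Rightarrow> complex^'n) \<Rightarrow> (nat \<Rightarrow> complex^'n)" where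
  "opCT C y = (\<lambda>k. if k = 0 then cm (transpose C) *v fst y else snd y (k - 1))"

definition opH :: "real^'n^'n \<Rightarrow> real^'n^'n \<Rightarrow> real^('k::finite \<times> 2)^'n \<Rightarrow> real^'n^'r \<Rightarrow> real \<Rightarrow>
    (complex^'r) \<times> (nat \<Rightarrow> complex^'n) \<Rightarrow> (complex^'r) \<times> (nat \<Rightarrow> complex^'n)" where
  "opH A Th B C th y = (fst y, \<lambda>j.
     ((- 2 * \<i> * complex_of_real th) ^ (j + 1) * complex_of_real (1 / fact (j + 2)))
       *s (cm (beta A Th B C (j + 1)) *v snd y j))"

definition Gtf :: "real^'n^'n \<Rightarrow> real^'n^'n \<Rightarrow> real^('k::finite \<times> 2)^'n \<Rightarrow> real^'n^'r \<Rightarrow>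
    ((nat \<Rightarrow> complex^'n) \<Rightarrow> complex^('k::finite \<times> 2)) \<Rightarrow> complex \<Rightarrow> complex^('k::finite \<times> 2)^('k::finite \<times> 2)" where
  "Gtf A Th B C L s = mat 1 + (\<chi> i j.
     L (inv_into l2X (shiftI s (\<lambda>x k. opA A Th B C x k + opB B (L x) k)) (opB B (axis j 1))) $ i)"

end

theory Submission
  imports Defs
begin

text \<open>
  On the imaginary axis every Lyapunov equation of the recursion turns into the identity
  \<open>G W G\<^sup>* = g G\<^sup>* (g\<^sup>-\<^sup>1 W g\<^sup>-\<^sup>1) G g\<close> for the resolvent \<open>G\<close>. Applying it repeatedly collapses
  \<open>G\<^sub>k\<^sup>* \<beta>\<^sub>k G\<^sub>k\<close> to \<open>(-1)\<^sup>k \<Psi>\<^sup>k\<close>, so that the quadratic form of \<open>C\<^sup>T H C\<close> on states generated by an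
  input \<open>u\<close> is the series \<open>\<langle>\<Sigma> u, u'\<rangle>\<close>. The closed-loop states driven by the unit
  vectors are open-loop states driven by the columns of the transfer matrix \<open>K\<close>; testing the Riccati
  equation on them gives \<open>K\<^sup>* \<Delta> K = I\<close>, which is the claim.
\<close>

section \<open>Matrix algebra and the matrix exponential\<close>

text \<open>Over a field a one-sided inverse of a square matrix is two-sided, so the Hilbert choice
  inside \<open>matrix_inv\<close> has a witness and can only return it.\<close>

lemma matrix_inv_unique:
  fixes M :: "'a::field^'n^'n"
  assumes "M ** N = mat 1"
  shows "matrix_inv M = N"
proof -
  have "N ** M = mat 1"
    using assms by (simp add: matrix_left_right_inverse)
  then have "M ** matrix_inv M = mat 1"
    unfolding matrix_inv_def using assms by (metis (mono_tags, lifting) someI_ex)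
  then have "N = N ** (M ** matrix_inv M)"
    by simp
  also have "\<dots> = matrix_inv M"
    by (simp add: matrix_mul_assoc \<open>N ** M = mat 1\<close>)
  finally show ?thesis by simp
qed

lemma matrix_inv_right:
  fixes M :: "'a::field^'n^'n"
  assumes "invertible M"
  shows "M ** matrix_inv M = mat 1"
  using assms matrix_inv_unique invertible_right_inverse by metis

lemma matrix_inv_left:
  fixes M :: "'a::field^'n^'n"
  assumes "invertible M"
  shows "matrix_inv M ** M = mat 1"
  using matrix_inv_right[OF assms] by (simp add: matrix_left_right_inverse)

lemma matrix_mult_minus_left: "(- M) ** N = - (M ** (N :: 'a::ring_1^'l^'n))"
  by (simp add: matrix_matrix_mult_def vec_eq_iff sum_negf)

lemma matrix_mult_minus_right: "M ** (- N) = - (M ** (N :: 'a::ring_1^'l^'n))"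
  by (simp add: matrix_matrix_mult_def vec_eq_iff sum_negf)

lemma matrix_diff_ldistrib: "M ** (N - P) = M ** N - M ** (P :: 'a::ring_1^'l^'n)"
  by (simp add: matrix_matrix_mult_def vec_eq_iff sum_subtractf algebra_simps)

lemma matrix_diff_rdistrib: "(N - P) ** M = N ** M - P ** (M :: 'a::ring_1^'l^'n)"
  by (simp add: matrix_matrix_mult_def vec_eq_iff sum_subtractf algebra_simps)

lemma matrix_add_rdistrib: "(N + P) ** M = N ** M + P ** (M :: 'a::semiring_1^'l^'n)"
  by (simp add: matrix_matrix_mult_def vec_eq_iff sum.distrib algebra_simps)

lemma mat_mult_commute: "mat s ** M = M ** mat (s :: 'a::comm_semiring_1)"
  by (simp add: matrix_matrix_mult_def mat_def vec_eq_iff if_distrib if_distribR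
      sum.delta sum.delta' mult.commute cong: if_cong)

lemma transpose_component: "transpose M $ i $ j = M $ j $ i"
  by (simp add: transpose_def)

lemma transpose_minus: "transpose (- M) = - transpose (M :: 'a::ring_1^'l^'n)"
  by (simp add: transpose_def vec_eq_iff)

lemma transpose_plus: "transpose (M + N) = transpose M + transpose N"
  by (simp add: transpose_def vec_eq_iff)

lemma matrix_inv_transpose:
  fixes M :: "'a::field^'n^'n"
  assumes "invertible M"
  shows "matrix_inv (transpose M) = transpose (matrix_inv M)"
  by (rule matrix_inv_unique)
     (simp add: matrix_inv_left[OF assms] flip: matrix_transpose_mul)

lemma matrix_inv_scaleR:
  fixes M :: "real^'n^'n"
  assumes "invertible M" "c \<noteq> 0"
  shows "matrix_inv (c *\<^sub>R M) = inverse c *\<^sub>R matrix_inv M"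
  by (rule matrix_inv_unique)
     (simp add: matrix_inv_right[OF assms(1)] matrix_scalar_ac scalar_matrix_assoc assms)

section \<open>Powers of a matrix\<close>

lemma mpow_commute: "M ** mpow M k = mpow M k ** M"
  by (induction k) (simp_all add: matrix_mul_assoc)

lemma mpow_transpose:
  fixes M :: "'a::comm_semiring_1^'n^'n"
  shows "mpow (transpose M) k = transpose (mpow M k)"
  by (induction k) (simp_all add: matrix_transpose_mul mpow_commute)

lemma mpow_scaleR: "mpow (c *\<^sub>R M) k = c ^ k *\<^sub>R mpow (M :: 'a::real_algebra_1^'n^'n) k"
  by (induction k) (simp_all add: matrix_matrix_mult_def vec_eq_iff sum_distrib_left scaleR_sum_right mult.commute)

lemma mpow_csmul: "mpow (csmul c M) k = csmul (c ^ k) (mpow M k)"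
  by (induction k)
     (simp_all add: matrix_matrix_mult_def vec_eq_iff csmul_def sum_distrib_left mult_ac)

text \<open>Push-through rule: an alternating product of \<open>P\<close> and \<open>N\<close> may
  be bracketed from either end. It drives the telescoping in \<open>nested_power_step\<close> and
  \<open>chain_power\<close>.\<close>

lemma mpow_sandwich: "mpow (P ** N) k ** P = P ** mpow (N ** P) k"
proof (induction k)
  case (Suc k)
  have "mpow (P ** N) (Suc k) ** P = P ** N ** (mpow (P ** N) k ** P)"
    by (simp add: matrix_mul_assoc)
  also have "\<dots> = P ** mpow (N ** P) (Suc k)"
    unfolding Suc.IH by (simp add: matrix_mul_assoc)
  finally show ?case .
qed simp

text \<open>The sum of the norms of all entries dominates every row sum, so each further factor
  costs at most this constant. This entrywise estimate takes the place of a submultiplicative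
  norm.\<close>

lemma mpow_entry_bound:
  fixes M :: "'a::real_normed_field^'n^'n"
  shows "norm (mpow M k $ i $ j) \<le> (\<Sum>i\<in>UNIV. \<Sum>l\<in>UNIV. norm (M $ i $ l)) ^ k"
proof (induction k arbitrary: i j)
  case 0
  then show ?case by (simp add: mat_def)
next
  case (Suc k)
  let ?c = "\<Sum>i\<in>UNIV. \<Sum>l\<in>UNIV. norm (M $ i $ l)"
  have row: "(\<Sum>l\<in>UNIV. norm (M $ i $ l)) \<le> ?c"
    by (rule member_le_sum) (simp_all add: sum_nonneg)
  have "norm (mpow M (Suc k) $ i $ j) \<le> (\<Sum>l\<in>UNIV. norm (M $ i $ l) * norm (mpow M k $ l $ j))"
    using norm_sum[of "\<lambda>l. M $ i $ l * mpow M k $ l $ j" UNIV]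
    by (simp add: matrix_matrix_mult_def norm_mult)
  also have "\<dots> \<le> (\<Sum>l\<in>UNIV. norm (M $ i $ l) * ?c ^ k)"
    by (intro sum_mono mult_left_mono Suc.IH) simp
  also have "\<dots> \<le> ?c * ?c ^ k"
    by (simp only: flip: sum_distrib_right)
       (intro mult_right_mono row zero_le_power sum_nonneg, simp_all)
  finally show ?case by simp
qed

section \<open>Entrywise convergence of matrix series and the matrix exponential\<close>

lemma sums_matrixI:
  fixes f :: "nat \<Rightarrow> 'a::real_normed_vector^'m^'n"
  assumes "\<And>i j. (\<lambda>k. f k $ i $ j) sums (L $ i $ j)"
  shows "f sums L"
  using assms unfolding sums_def
  by (intro vec_tendstoI) (simp add: sum_component)

lemma summable_matrixI:
  fixes f :: "nat \<Rightarrow> 'a::real_normed_vector^'m^'n"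
  assumes "\<And>i j. summable (\<lambda>k. f k $ i $ j)"
  shows "summable f"
proof -
  have "f sums (\<chi> i j. \<Sum>k. f k $ i $ j)"
    by (rule sums_matrixI) (simp add: assms summable_sums)
  then show ?thesis by (rule sums_summable)
qed

text \<open>Comparison with the scalar exponential series, entry by entry. Only a bound on the
  coefficients is asked for, so that both \<open>mexp\<close> and \<open>phi_mat\<close> are
  covered.\<close>

lemma summable_mpow_series:
  fixes M :: "'a::{real_normed_field,banach}^'n^'n"
  assumes "\<And>k. \<bar>c k\<bar> \<le> 1 / fact k"
  shows "summable (\<lambda>k. c k *\<^sub>R mpow M k)"
proof (rule summable_matrixI)
  fix i j
  let ?b = "\<Sum>i\<in>UNIV. \<Sum>l\<in>UNIV. norm (M $ i $ l)"
  have "summable (\<lambda>k. inverse (fact k) * ?b ^ k)"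
    by (rule summable_exp)
  then show "summable (\<lambda>k. (c k *\<^sub>R mpow M k) $ i $ j)"
  proof (rule summable_comparison_test'[where N=0])
    fix k
    show "norm ((c k *\<^sub>R mpow M k) $ i $ j) \<le> inverse (fact k) * ?b ^ k"
      using mult_mono[OF assms[of k] mpow_entry_bound[of M k i j]]
      by (simp add: divide_inverse)
  qed
qed

lemma mexp_sums: "(\<lambda>k. (1 / fact k) *\<^sub>R mpow M k) sums mexp M"
  unfolding mexp_def by (intro summable_sums summable_mpow_series) simp

text \<open>Each entry is a scalar power series in \<open>t\<close>, which makes termwise
  differentiation available.\<close>

lemma mexp_entry_sums: "(\<lambda>k. mpow M k $ i $ j / fact k * t ^ k) sums (mexp (t *\<^sub>R M) $ i $ j)"
proof -
  have "bounded_linear (\<lambda>X::real^_^_. X $ i $ j)"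
    by (rule bounded_linear_compose[of "\<lambda>x. x $ j"]) auto
  from bounded_linear.sums[OF this mexp_sums[of "t *\<^sub>R M"]] show ?thesis
    by (simp add: mpow_scaleR mult_ac)
qed

lemma mexp_transpose: "mexp (transpose M) = transpose (mexp M)"
proof -
  have "(\<lambda>k. (1 / fact k) *\<^sub>R mpow (transpose M) k) sums transpose (mexp M)"
  proof (rule sums_matrixI)
    fix i j
    show "(\<lambda>k. ((1 / fact k) *\<^sub>R mpow (transpose M) k) $ i $ j) sums transpose (mexp M) $ i $ j"
      using mexp_entry_sums[of M j i 1] by (simp add: mpow_transpose transpose_component)
  qed
  then show ?thesis using mexp_sums sums_unique2 by blast
qed

lemma mexp_entry_deriv:
  "((\<lambda>t. mexp (t *\<^sub>R M) $ i $ j) has_field_derivative (M ** mexp (t *\<^sub>R M)) $ i $ j) (at t)"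
proof -
  define c where "c k = mpow M k $ i $ j / fact k" for k
  have eq: "mexp (t *\<^sub>R M) $ i $ j = (\<Sum>k. c k * t ^ k)" for t
    using mexp_entry_sums[of M i j t] by (simp add: c_def sums_iff)
  have "((\<lambda>t. \<Sum>k. c k * t ^ k) has_field_derivative (\<Sum>k. diffs c k * t ^ k)) (at t)"
    by (rule termdiffs_strong_converges_everywhere)
       (use mexp_entry_sums[of M i j] in \<open>auto simp: c_def sums_iff\<close>)
  moreover have "(\<lambda>k. diffs c k * t ^ k) sums ((M ** mexp (t *\<^sub>R M)) $ i $ j)"
  proof -
    have "(\<lambda>k. \<Sum>l\<in>UNIV. M $ i $ l * (mpow M k $ l $ j / fact k * t ^ k)) sums
        (\<Sum>l\<in>UNIV. M $ i $ l * mexp (t *\<^sub>R M) $ l $ j)"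
      by (intro sums_sum sums_mult mexp_entry_sums)
    moreover have "diffs c k = (\<Sum>l\<in>UNIV. M $ i $ l * mpow M k $ l $ j) / fact k" for k
      by (simp add: diffs_def c_def matrix_matrix_mult_def field_simps del: of_nat_Suc)
    ultimately show ?thesis
      by (simp add: matrix_matrix_mult_def sum_distrib_left sum_divide_distrib mult_ac)
  qed
  ultimately show ?thesis by (simp add: eq sums_iff)
qed

lemma has_vector_derivative_matrixI:
  fixes f :: "real \<Rightarrow> real^'m^'n"
  assumes "\<And>i j. ((\<lambda>t. f t $ i $ j) has_field_derivative D $ i $ j) (at t)"
  shows "(f has_vector_derivative D) (at t)"
  unfolding has_vector_derivative_def
proof (subst has_derivative_componentwise_within, intro ballI)
  fix b :: "real^'m^'n"
  assume "b \<in> Basis"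
  then obtain i j where "b = axis i (axis j 1)"
    by (auto simp: Basis_vec_def)
  then show "((\<lambda>x. f x \<bullet> b) has_derivative (\<lambda>x. (x *\<^sub>R D) \<bullet> b)) (at t)"
    using assms[of i j]
    by (simp add: inner_axis has_field_derivative_def mult.commute[of _ "D $ i $ j"])
qed

text \<open>Product rule, carried out on entries. The right factor is the transpose of the left one,
  so the derivative of \<open>mexp (t *\<^sub>R M)\<close> settles both.\<close>

lemma lyapunov_integrand_deriv:
  fixes M U :: "real^'n^'n"
  defines "f \<equiv> \<lambda>t. mexp (t *\<^sub>R M) ** U ** mexp (t *\<^sub>R transpose M)"
  shows "(f has_vector_derivative (M ** f t + f t ** transpose M)) (at t)"
proof (rule has_vector_derivative_matrixI)
  fix i j
  have T: "mexp (t *\<^sub>R transpose M) = transpose (mexp (t *\<^sub>R M))" for t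
    by (simp add: mexp_transpose flip: transpose_scalar)
  have "f t $ i $ j = (\<Sum>l\<in>UNIV. \<Sum>p\<in>UNIV. mexp (t *\<^sub>R M) $ i $ p * U $ p $ l * mexp (t *\<^sub>R M) $ j $ l)" for t
    by (simp add: f_def T matrix_matrix_mult_def transpose_component sum_distrib_right)
  moreover have "((\<lambda>t. \<Sum>l\<in>UNIV. \<Sum>p\<in>UNIV. mexp (t *\<^sub>R M) $ i $ p * U $ p $ l * mexp (t *\<^sub>R M) $ j $ l)
      has_field_derivative (\<Sum>l\<in>UNIV. \<Sum>p\<in>UNIV. (M ** mexp (t *\<^sub>R M)) $ i $ p * U $ p $ l * mexp (t *\<^sub>R M) $ j $ l
        + mexp (t *\<^sub>R M) $ i $ p * U $ p $ l * (M ** mexp (t *\<^sub>R M)) $ j $ l)) (at t)"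
    by (intro DERIV_sum) (auto intro!: derivative_eq_intros mexp_entry_deriv)
  moreover have "M ** f t + f t ** transpose M =
      (M ** mexp (t *\<^sub>R M)) ** U ** transpose (mexp (t *\<^sub>R M))
      + mexp (t *\<^sub>R M) ** U ** transpose (M ** mexp (t *\<^sub>R M))"
    by (simp add: f_def T matrix_mul_assoc matrix_transpose_mul)
  moreover have "(X ** U ** transpose Y) $ i $ j = (\<Sum>l\<in>UNIV. \<Sum>p\<in>UNIV. X $ i $ p * U $ p $ l * Y $ j $ l)" for X Y
    by (simp add: matrix_matrix_mult_def transpose_def sum_distrib_right)
  ultimately show "((\<lambda>t. f t $ i $ j) has_field_derivative (M ** f t + f t ** transpose M) $ i $ j) (at t)"
    by (simp add: sum.distrib)
qed

section \<open>Lyapunov integrals\<close>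

lemma mexp_zero: "mexp (0 :: real^'n^'n) = mat 1"
proof -
  have "mexp (0 *\<^sub>R 0) $ i $ j = mat 1 $ i $ j" for i j :: 'n
    using sums_unique2[OF mexp_entry_sums[of "0 :: real^'n^'n" i j 0]
        powser_sums_zero[of "\<lambda>k. mpow 0 k $ i $ j / fact k"]]
    by simp
  then show ?thesis by (simp add: vec_eq_iff)
qed

text \<open>The integral over an unbounded set is approximated on all large boxes; the box from -t
  to t meets the half line in the interval from 0 to t.\<close>

lemma improper_integral_tendsto:
  fixes f :: "real \<Rightarrow> 'a::euclidean_space"
  assumes "f integrable_on {0..}"
  shows "((\<lambda>t. integral {0..t} f) \<longlongrightarrow> integral {0..} f) at_top"
proof (rule tendstoI)
  fix e :: real
  assume "e > 0"
  \<comment> \<open>The approximation by boxes is the characterisation for domains that are not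
    boxes themselves.\<close>
  have nbox: "\<not> (\<exists>a b. {0::real..} = cbox a b)"
  proof
    assume "\<exists>a b. {0::real..} = cbox a b"
    then obtain a b where "{0::real..} = {a..b}" by auto
    moreover have "max 0 (b + 1) \<in> {0..}" by simp
    ultimately have "max 0 (b + 1) \<in> {a..b}" by (simp only:)
    then show False by simp
  qed
  obtain K where K: "\<And>a b. ball 0 K \<subseteq> cbox a b \<Longrightarrow>
      \<exists>z. ((\<lambda>x. if x \<in> {0..} then f x else 0) has_integral z) (cbox a b) \<and> norm (z - integral {0..} f) < e"
    by (rule has_integral_altD[OF integrable_integral[OF assms] nbox \<open>e > 0\<close>]) blast
  have "dist (integral {0..t} f) (integral {0..} f) < e" if "t \<ge> K" for t
  proof -
    have "ball 0 K \<subseteq> cbox (-t) t"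
      using that by (auto simp: dist_real_def)
    then obtain z where z: "((\<lambda>x. if x \<in> {0..} then f x else 0) has_integral z) (cbox (-t) t)"
      "norm (z - integral {0..} f) < e"
      using K by blast
    have "{0..} \<inter> cbox (-t) t = {0..t}" by auto
    moreover have "(f has_integral z) ({0..} \<inter> cbox (-t) t)"
      using z(1) by (simp only: has_integral_restrict_Int)
    ultimately have "(f has_integral z) {0..t}"
      by (simp only:)
    then show ?thesis using z(2) by (simp add: integral_unique dist_norm)
  qed
  then show "\<forall>\<^sub>F t in at_top. dist (integral {0..t} f) (integral {0..} f) < e"
    by (intro eventually_mono[OF eventually_ge_at_top[of K]])
qed

text \<open>The integral over the window from t to t+1 tends to 0, as a difference of values of a
  convergent primitive, and to \<open>l\<close>, as an average of \<open>f\<close> over a unit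
  interval.\<close>

lemma limit_zero_of_integrable:
  fixes f :: "real \<Rightarrow> 'a::euclidean_space"
  assumes int: "f integrable_on {0..}" and lim: "(f \<longlongrightarrow> l) at_top"
  shows "l = 0"
proof -
  let ?I = "\<lambda>t. integral {0..t} f"
  have int': "f integrable_on {a..b}" if "0 \<le> a" for a b
    using that by (intro integrable_on_subinterval[OF int]) auto
  have "filterlim (\<lambda>t::real. t + 1) at_top at_top"
    using filterlim_tendsto_add_at_top[OF tendsto_const[of "1::real"] filterlim_ident]
    by (simp only: add.commute)
  then have "((\<lambda>t. ?I (t + 1) - ?I t) \<longlongrightarrow> integral {0..} f - integral {0..} f) at_top"
    by (intro tendsto_diff improper_integral_tendsto[OF int]
        filterlim_compose[OF improper_integral_tendsto[OF int]])
  moreover have "((\<lambda>t. ?I (t + 1) - ?I t) \<longlongrightarrow> l) at_top"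
  proof (rule tendstoI)
    fix e :: real
    assume "e > 0"
    then obtain K where K: "\<And>t. t \<ge> K \<Longrightarrow> dist (f t) l < e / 2"
      using tendstoD[OF lim, of "e / 2"] by (auto simp: eventually_at_top_linorder)
    have "dist (?I (t + 1) - ?I t) l < e" if "t \<ge> max K 0" for t
    proof -
      have split: "?I t + integral {t..t+1} f = ?I (t + 1)"
        using that by (intro Henstock_Kurzweil_Integration.integral_combine int') auto
      have "((\<lambda>x. f x - l) has_integral (integral {t..t+1} f - l)) {t..t+1}"
        using that has_integral_diff[OF integrable_integral[OF int'[of t "t+1"]] has_integral_const_real[of l t "t+1"]]
        by simp
      then have "norm (integral {t..t+1} f - l) \<le> e / 2 * measure lborel {t..t+1}"
        using K that \<open>e > 0\<close>
        by (intro has_integral_bound_real[where f="\<lambda>x. f x - l"]) (auto simp: dist_norm less_imp_le)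
      moreover have "measure lborel {t..t+1} = 1" by simp
      moreover have "?I (t + 1) - ?I t = integral {t..t+1} f"
        unfolding split[symmetric] by simp
      ultimately have "norm (?I (t + 1) - ?I t - l) \<le> e / 2"
        by (simp only: mult_1_right)
      then show ?thesis using \<open>e > 0\<close> by (simp add: dist_norm)
    qed
    then show "\<forall>\<^sub>F t in at_top. dist (?I (t + 1) - ?I t) l < e"
      by (intro eventually_mono[OF eventually_ge_at_top[of "max K 0"]])
  qed
  ultimately have "integral {0..} f - integral {0..} f = l"
    by (intro tendsto_unique[OF trivial_limit_at_top_linorder])
  then show ?thesis by simp
qed

lemma LA_integrable:
  assumes "LA M U \<noteq> 0"
  shows "(\<lambda>t. mexp (t *\<^sub>R M) ** U ** mexp (t *\<^sub>R transpose M)) integrable_on {0..}"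
  using assms not_integrable_integral unfolding LA_def by blast

text \<open>Nonvanishing of the integral replaces exponential decay: a divergent integral
  has the junk value 0, and for a convergent one the integrand has a limit by the
  differential equation it satisfies, which then must be 0.\<close>

lemma LA_lyapunov:
  fixes M U :: "real^'n^'n"
  assumes "LA M U \<noteq> 0"
  shows "M ** LA M U + LA M U ** transpose M + U = 0"
proof -
  define f where "f = (\<lambda>t. mexp (t *\<^sub>R M) ** U ** mexp (t *\<^sub>R transpose M))"
  define h where "h = (\<lambda>X :: real^'n^'n. M ** X + X ** transpose M)"
  have int: "f integrable_on {0..}"
    using LA_integrable[OF assms] by (simp add: f_def)
  have "linear h"
    by (rule linearI) (simp_all add: h_def matrix_add_ldistrib matrix_add_rdistrib matrix_scalar_ac
        scaleR_add_right flip: scalar_matrix_assoc)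
  then have h: "bounded_linear h"
    by (simp add: linear_linear)
  have f0: "f 0 = U"
    by (simp add: f_def mexp_zero)
  \<comment> \<open>Integrating \<open>f' = h f\<close> and pulling the linear map \<open>h\<close>
    out of the integral expresses \<open>f t\<close> through a partial integral, whose convergence
    then forces \<open>f\<close> to converge.\<close>
  have ft: "f t = U + h (integral {0..t} f)" if "t \<ge> 0" for t
  proof -
    have "((\<lambda>t. h (f t)) has_integral (f t - f 0)) {0..t}"
      using that lyapunov_integrand_deriv[of M U]
      by (intro fundamental_theorem_of_calculus)
         (auto simp: f_def h_def intro: has_vector_derivative_at_within)
    moreover have "f integrable_on {0..t}"
      by (intro integrable_on_subinterval[OF int]) auto
    then have "((\<lambda>t. h (f t)) has_integral h (integral {0..t} f)) {0..t}"
      using has_integral_linear[OF integrable_integral h] by (simp add: o_def)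
    ultimately have "f t - f 0 = h (integral {0..t} f)"
      by (rule has_integral_unique)
    then show ?thesis by (simp add: f0 algebra_simps)
  qed
  have "((\<lambda>t. U + h (integral {0..t} f)) \<longlongrightarrow> U + h (integral {0..} f)) at_top"
    by (intro tendsto_intros bounded_linear.tendsto[OF h] improper_integral_tendsto int)
  then have "(f \<longlongrightarrow> U + h (integral {0..} f)) at_top"
    by (rule Lim_transform_eventually)
       (rule eventually_mono[OF eventually_ge_at_top[of 0]], rule ft[symmetric])
  then have "U + h (integral {0..} f) = 0"
    by (rule limit_zero_of_integrable[OF int])
  then show ?thesis by (simp add: h_def f_def LA_def add.commute)
qed

text \<open>The integrand is a congruence of \<open>U\<close>, so it inherits the factor
  \<open>c\<close>, and transposition passes through the integral as a linear map. The factor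
  \<open>c\<close> treats symmetric and antisymmetric \<open>U\<close> at once.\<close>

lemma LA_transpose:
  fixes M U :: "real^'n^'n"
  assumes "LA M U \<noteq> 0" and "transpose U = c *\<^sub>R U"
  shows "transpose (LA M U) = c *\<^sub>R LA M U"
proof -
  define f where "f = (\<lambda>t. mexp (t *\<^sub>R M) ** U ** mexp (t *\<^sub>R transpose M))"
  have int: "f integrable_on {0..}"
    using LA_integrable[OF assms(1)] by (simp add: f_def)
  have "linear (transpose :: real^'n^'n \<Rightarrow> _)"
    by (rule linearI) (simp_all add: transpose_plus transpose_scalar)
  then have "integral {0..} (transpose \<circ> f) = transpose (integral {0..} f)"
    by (intro integral_linear int) (simp add: linear_linear)
  moreover have "transpose \<circ> f = (\<lambda>t. c *\<^sub>R f t)"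
  proof
    fix t
    have "mexp (t *\<^sub>R transpose M) = transpose (mexp (t *\<^sub>R M))"
      by (simp add: mexp_transpose flip: transpose_scalar)
    then show "(transpose \<circ> f) t = c *\<^sub>R f t"
      by (simp add: f_def matrix_transpose_mul assms(2) matrix_scalar_ac matrix_mul_assoc
          flip: scalar_matrix_assoc)
  qed
  ultimately show ?thesis by (simp add: f_def LA_def)
qed

section \<open>Powers of \<open>\<Psi>\<close> along the recursion\<close>

lemma cm_mult: "cm (M ** N) = cm M ** cm N"
  by (simp add: cm_def matrix_matrix_mult_def vec_eq_iff)

lemma cm_add: "cm (M + N) = cm M + cm N"
  by (simp add: cm_def vec_eq_iff)

lemma cm_minus: "cm (- M) = - cm M"
  by (simp add: cm_def vec_eq_iff)

lemma cm_zero: "cm 0 = 0"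
  by (simp add: cm_def vec_eq_iff)

lemma cm_mat_one: "cm (mat 1) = mat 1"
  by (simp add: cm_def mat_def vec_eq_iff)

lemma cm_transpose: "cm (transpose M) = cadj (cm M)"
  by (simp add: cm_def cadj_def transpose_def vec_eq_iff)

lemma cadj_mult: "cadj (M ** N) = cadj N ** cadj M"
  by (simp add: cadj_def matrix_matrix_mult_def vec_eq_iff mult.commute)

lemma cadj_cadj: "cadj (cadj M) = M"
  by (simp add: cadj_def vec_eq_iff)

lemma cadj_diff: "cadj (M - N) = cadj M - cadj N"
  by (simp add: cadj_def vec_eq_iff)

lemma cadj_mat: "cadj (mat s) = mat (cnj s)"
  by (simp add: cadj_def mat_def vec_eq_iff)

lemma mat_uminus: "mat (- s :: 'a::ring_1) = - mat s"
  by (simp add: mat_def vec_eq_iff)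

text \<open>\<open>X\<close> occurs twice, so its sign cancels and only the sign of \<open>Y\<close>
  survives.\<close>

lemma transpose_congruence:
  fixes X Y :: "real^'n^'n"
  assumes "transpose X = c *\<^sub>R X" "transpose Y = d *\<^sub>R Y" "c * c = 1"
  shows "transpose (X ** Y ** X) = d *\<^sub>R (X ** Y ** X)"
proof -
  have "transpose (X ** Y ** X) = (c * c * d) *\<^sub>R (X ** Y ** X)"
    by (simp add: matrix_transpose_mul assms(1,2) matrix_scalar_ac matrix_mul_assoc mult_ac
        flip: scalar_matrix_assoc)
  then show ?thesis by (simp add: assms(3))
qed

text \<open>A kernel vector would be an eigenvector for the eigenvalue \<open>s\<close>, which the
  Hurwitz property excludes.\<close>

lemma resolvent_invertible:
  assumes "hurwitz A" "Re s \<ge> 0"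
  shows "invertible (mat s - cm A)"
  unfolding invertible_left_inverse matrix_left_invertible_ker
proof (intro allI impI)
  fix v
  assume "(mat s - cm A) *v v = 0"
  moreover have "mat s *v v = s *s v"
    by (simp add: matrix_vector_mult_def mat_def vec_eq_iff if_distrib if_distribR cong: if_cong)
  ultimately have "cm A *v v = s *s v"
    by (simp add: matrix_vector_mult_diff_rdistrib)
  then show "v = 0"
    using assms by (force simp: hurwitz_def)
qed

text \<open>Both sides equal \<open>g G\<^sup>* + G g\<close>: the Lyapunov equation reads
  \<open>W = R g + g R\<^sup>*\<close> with \<open>R = G\<^sup>-\<^sup>1\<close>.\<close>

lemma lyapunov_resolvent:
  fixes A g W :: "real^'n^'n" and lam :: real
  defines "G \<equiv> matrix_inv (mat (\<i> * lam) - cm A)"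
  assumes hurw: "hurwitz A" and inv: "invertible g"
    and lyap: "A ** g + g ** transpose A + W = 0"
  shows "G ** cm W ** cadj G =
    cm g ** (cadj G ** cm (matrix_inv g ** W ** matrix_inv g) ** G) ** cm g"
proof -
  define R where "R = mat (\<i> * lam) - cm A"
  define h where "h = cm (matrix_inv g)"
  have R: "invertible R"
    unfolding R_def by (rule resolvent_invertible[OF hurw]) simp
  have RG: "R ** G = mat 1" and GR: "G ** R = mat 1"
    using matrix_inv_right[OF R] matrix_inv_left[OF R] by (simp_all add: G_def R_def)
  have RGs: "cadj R ** cadj G = mat 1" and GRs: "cadj G ** cadj R = mat 1"
    using RG GR by (simp_all add: cadj_mat flip: cadj_mult)
  have gh: "cm g ** h = mat 1" and hg: "h ** cm g = mat 1"
    by (simp_all add: h_def matrix_inv_right[OF inv] matrix_inv_left[OF inv] cm_mat_one flip: cm_mult)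
  have "cm A ** cm g + cm g ** cadj (cm A) + cm W = 0"
    using lyap by (simp add: cm_zero flip: cm_mult cm_add cm_transpose)
  \<comment> \<open>Here the restriction to the imaginary axis enters: the scalar parts of
    \<open>R\<close> and \<open>cadj R\<close> are opposite, so their contributions to the
    right-hand side cancel.\<close>
  then have W: "cm W = R ** cm g + cm g ** cadj R"
    by (simp add: R_def cadj_diff cadj_mat matrix_diff_ldistrib matrix_diff_rdistrib mat_mult_commute mat_uminus
        matrix_mult_minus_right eq_neg_iff_add_eq_0 algebra_simps)
  have "G ** cm W ** cadj G = (G ** R) ** cm g ** cadj G + G ** cm g ** (cadj R ** cadj G)"
    by (simp add: W matrix_add_ldistrib matrix_add_rdistrib matrix_mul_assoc)
  also have "\<dots> = cm g ** cadj G + G ** cm g"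
    by (simp add: GR RGs)
  finally have L: "G ** cm W ** cadj G = cm g ** cadj G + G ** cm g" .
  have "h ** cm W ** h = h ** R ** (cm g ** h) + (h ** cm g) ** cadj R ** h"
    by (simp add: W matrix_add_ldistrib matrix_add_rdistrib matrix_mul_assoc)
  then have b: "cm (matrix_inv g ** W ** matrix_inv g) = h ** R + cadj R ** h"
    unfolding cm_mult h_def[symmetric] by (simp only: gh hg matrix_mul_lid matrix_mul_rid)
  have "cm g ** (cadj G ** (h ** R + cadj R ** h) ** G) ** cm g =
      cm g ** cadj G ** h ** (R ** G) ** cm g + cm g ** (cadj G ** cadj R) ** h ** G ** cm g"
    by (simp add: matrix_add_ldistrib matrix_add_rdistrib matrix_mul_assoc)
  also have "\<dots> = cm g ** cadj G ** (h ** cm g) + (cm g ** h) ** G ** cm g"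
    by (simp add: RG GRs matrix_mul_assoc)
  also have "\<dots> = cm g ** cadj G + G ** cm g"
    by (simp add: gh hg)
  finally show ?thesis by (simp add: L b)
qed

text \<open>One level of the telescoping. Applied with \<open>D\<close> at level j+1, it leaves
  \<open>Gs ** b ** G\<close>, which is \<open>D\<close> at level j, and raises the exponent by
  one.\<close>

lemma nested_power_step:
  fixes g D b G W Gs :: "'a::semiring_1^'n^'n"
  assumes "g ** D ** g = G ** W ** Gs"
  shows "(Gs ** b ** g) ** D ** mpow (g ** b ** g ** D) k ** (g ** b ** G) =
    (Gs ** b ** G) ** mpow (W ** (Gs ** b ** G)) (Suc k)"
proof -
  have "(Gs ** b ** g) ** D ** mpow (g ** b ** g ** D) k ** (g ** b ** G) =
      Gs ** b ** g ** D ** (mpow (g ** (b ** g ** D)) k ** g) ** b ** G"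
    by (simp add: matrix_mul_assoc)
  also have "\<dots> = Gs ** b ** (g ** D ** g) ** mpow (b ** (g ** D ** g)) k ** b ** G"
    unfolding mpow_sandwich by (simp add: matrix_mul_assoc)
  also have "\<dots> = Gs ** b ** G ** W ** Gs ** (mpow ((b ** G) ** (W ** Gs)) k ** (b ** G))"
    unfolding assms by (simp add: matrix_mul_assoc)
  also have "\<dots> = (Gs ** b ** G) ** mpow (W ** (Gs ** b ** G)) (Suc k)"
    unfolding mpow_sandwich by (simp add: matrix_mul_assoc)
  finally show ?thesis .
qed

text \<open>\<open>forcing j\<close> is the inhomogeneity in the Lyapunov equation satisfied by \<open>gamma j\<close>.\<close>

definition forcing :: "real^'n^'n \<Rightarrow> real^'n^'n \<Rightarrow> real^('k::finite \<times> 2)^'n \<Rightarrow> real^'n^'r \<Rightarrow> nat \<Rightarrow> real^'n^'n" where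
  "forcing A Th B C j = (case j of 0 \<Rightarrow> mho B
     | Suc i \<Rightarrow> alpha A Th B C (Suc i) ** (if i = 0 then PiC C else mat 1) ** gamma A Th B C i)"

text \<open>With \<open>a j\<close> equal to \<open>alpha\<close> at index j+1, the product
  \<open>G ** chain G a j ** cadj (cm C)\<close> is the component of index j+1 of the transfer
  function from the output of the original system to the infinite state.\<close>

primrec chain :: "complex^'n^'n \<Rightarrow> (nat \<Rightarrow> complex^'n^'n) \<Rightarrow> nat \<Rightarrow> complex^'n^'n" where
  "chain G a 0 = a 0"
| "chain G a (Suc j) = a (Suc j) ** G ** chain G a j"

text \<open>Taking \<open>mho B\<close> as the forcing of index 0 merges the starting value of
  \<open>beta\<close> at index 1 with its recursion into a single formula.\<close>

lemma recursion_simps: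
  "gamma A Th B C 0 = Th"
  "alpha A Th B C (Suc 0) = Th"
  "gamma A Th B C (Suc j) = LA A (forcing A Th B C (Suc j))"
  "alpha A Th B C (Suc (Suc j)) = gamma A Th B C (Suc j) ** beta A Th B C (Suc j)"
  "beta A Th B C (Suc j) =
    matrix_inv (gamma A Th B C j) ** forcing A Th B C j ** matrix_inv (gamma A Th B C j)"
  by (simp_all add: gamma_def alpha_def beta_def forcing_def abg_step_def Let_def matrix_mul_assoc
      split: nat.split)

text \<open>From index 2 on, the forcing is a congruence of the preceding \<open>beta\<close> by the
  preceding \<open>gamma\<close>; this shape lets consecutive levels telescope.\<close>

lemma forcing_simps:
  "forcing A Th B C 0 = mho B"
  "forcing A Th B C (Suc 0) = Th ** PiC C ** Th"
  "forcing A Th B C (Suc (Suc j)) =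
    gamma A Th B C (Suc j) ** beta A Th B C (Suc j) ** gamma A Th B C (Suc j)"
  by (simp_all add: forcing_def recursion_simps(1,2,4))

section \<open>Lyapunov equations and transposition signs of the recursion\<close>

locale nonsingular_recursion =
  fixes A Th :: "real^'n^'n" and B :: "real^('k::finite \<times> 2)^'n" and C :: "real^'n^'r"
  assumes Th_antisym: "transpose Th = - Th"
    and Th_nonsing: "det Th \<noteq> 0"
    and A_hurwitz: "hurwitz A"
    and lyap: "A ** Th + Th ** transpose A + mho B = 0"
    and gamma_nonsing: "\<And>k. k \<ge> 1 \<Longrightarrow> det (gamma A Th B C k) \<noteq> 0"
begin

lemma gamma_invertible: "invertible (gamma A Th B C j)"
  using Th_nonsing gamma_nonsing by (cases j) (simp_all add: invertible_det_nz recursion_simps(1))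

text \<open>A divergent integral would evaluate to 0 and make \<open>gamma\<close> singular, so
  nonsingularity supplies the convergence of the integrals in the recursion.\<close>

lemma LA_forcing_nonzero: "LA A (forcing A Th B C (Suc j)) \<noteq> 0"
  using gamma_nonsing[of "Suc j"] det_0[where 'n='n] by (auto simp: recursion_simps(3))

lemma gamma_lyapunov:
  "A ** gamma A Th B C j + gamma A Th B C j ** transpose A + forcing A Th B C j = 0"
proof (cases j)
  case 0
  then show ?thesis using lyap by (simp add: recursion_simps(1) forcing_simps(1))
next
  case (Suc i)
  then show ?thesis
    using LA_lyapunov[OF LA_forcing_nonzero] by (simp add: recursion_simps(3))
qed

text \<open>The three signs are carried together: \<open>forcing\<close> takes its sign from the
  \<open>beta\<close> of the previous level, \<open>gamma\<close> takes it from
  \<open>forcing\<close>, and the next \<open>beta\<close> is a congruence of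
  \<open>forcing\<close>. Passing from one \<open>beta\<close> to the next \<open>forcing\<close>
  shifts the exponent by two, which leaves the sign unchanged.\<close>

lemma recursion_transpose:
  "transpose (forcing A Th B C j) = (-1) ^ Suc j *\<^sub>R forcing A Th B C j \<and>
   transpose (gamma A Th B C j) = (-1) ^ Suc j *\<^sub>R gamma A Th B C j \<and>
   transpose (beta A Th B C (Suc j)) = (-1) ^ Suc j *\<^sub>R beta A Th B C (Suc j)"
proof (induction j rule: less_induct)
  case (less j)
  let ?W = "forcing A Th B C" and ?g = "gamma A Th B C" and ?b = "beta A Th B C"
  have sq: "(-1) ^ n * (-1) ^ n = (1 :: real)" for n
    by (simp flip: power_add)
  consider "j = 0" | "j = 1" | i where "j = Suc (Suc i)"
    by (metis One_nat_def not0_implies_Suc)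
  then have W: "transpose (?W j) = (-1) ^ Suc j *\<^sub>R ?W j"
  proof cases
    case 1
    \<comment> \<open>Antisymmetry of \<open>mho B\<close> is read off the Lyapunov equation for
      \<open>Th\<close>.\<close>
    have mho: "mho B = - (A ** Th + Th ** transpose A)"
      using lyap by (metis add.commute eq_neg_iff_add_eq_0)
    have "transpose (A ** Th + Th ** transpose A) = - (A ** Th + Th ** transpose A)"
      by (simp add: transpose_plus matrix_transpose_mul Th_antisym
          matrix_mult_minus_left matrix_mult_minus_right)
    then have "transpose (mho B) = - mho B"
      unfolding mho transpose_minus by (simp only:)
    then show ?thesis by (simp add: 1 forcing_simps(1))
  next
    case 2
    then show ?thesis
      by (simp add: forcing_simps(2) matrix_transpose_mul Th_antisym PiC_def
          matrix_mult_minus_left matrix_mult_minus_right matrix_mul_assoc)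
  next
    case (3 i)
    then show ?thesis
      using transpose_congruence[of "?g (Suc i)" "(-1) ^ Suc (Suc i)" "?b (Suc i)" "(-1) ^ Suc i"]
        less.IH[of "Suc i"] less.IH[of i] sq[of "Suc (Suc i)"]
      by (simp add: forcing_simps(3))
  qed
  have g: "transpose (?g j) = (-1) ^ Suc j *\<^sub>R ?g j"
  proof (cases j)
    case 0
    then show ?thesis by (simp add: recursion_simps(1) Th_antisym)
  next
    case (Suc i)
    then show ?thesis
      using LA_transpose[OF LA_forcing_nonzero W[unfolded Suc]] by (simp add: recursion_simps(3))
  qed
  have "transpose (matrix_inv (?g j)) = (-1) ^ Suc j *\<^sub>R matrix_inv (?g j)"
    using matrix_inv_transpose[OF gamma_invertible[of j]] g
      matrix_inv_scaleR[OF gamma_invertible[of j], of "(-1) ^ Suc j"]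
    by (simp add: power_inverse[symmetric])
  then have "transpose (?b (Suc j)) = (-1) ^ Suc j *\<^sub>R ?b (Suc j)"
    unfolding recursion_simps(5) using W sq by (rule transpose_congruence)
  with W g show ?case by blast
qed

text \<open>\<open>gamma\<close> and \<open>beta\<close> of the same index have opposite signs under
  transposition. The resulting minus is the source of the alternating sign in
  \<open>chain_power\<close>.\<close>

lemma alpha_transpose:
  "transpose (alpha A Th B C (Suc (Suc j))) = - (beta A Th B C (Suc j) ** gamma A Th B C (Suc j))"
  using recursion_transpose[of j] recursion_transpose[of "Suc j"]
  by (simp add: recursion_simps(4) matrix_transpose_mul matrix_scalar_ac matrix_mult_minus_left
      flip: scalar_matrix_assoc power_mult_distrib)

text \<open>The product is peeled from its middle: the resolvent identity replaces the innermost
  block by one of the level below at the price of one more power, until level 0 is reached and the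
  power becomes one of \<open>Psi\<close>.\<close>

lemma chain_power:
  fixes lam :: real
  defines "G \<equiv> matrix_inv (mat (\<i> * lam) - cm A)"
    and "a \<equiv> \<lambda>j. cm (alpha A Th B C (Suc j))"
  shows "cadj (G ** chain G a j ** cadj (cm C)) ** cm (beta A Th B C (Suc j))
      ** (G ** chain G a j ** cadj (cm C)) = (-1) ^ Suc j *\<^sub>R mpow (Psi A B C lam) (Suc j)"
proof -
  define g where "g = (\<lambda>j. cm (gamma A Th B C j))"
  define b where "b = (\<lambda>j. cm (beta A Th B C (Suc j)))"
  define W where "W = (\<lambda>j. cm (forcing A Th B C j))"
  define D where "D = (\<lambda>j. cadj G ** b j ** G)"
  define E where "E = chain G a"
  \<comment> \<open>The mirror image of \<open>E\<close>, equal to its adjoint up to a sign, so that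
    the telescoping itself is free of signs.\<close>
  define Es where "Es = rec_nat (cm Th) (\<lambda>j X. X ** cadj G ** b j ** g (Suc j))"
  have gDg: "g j ** D j ** g j = G ** W j ** cadj G" for j
    using lyapunov_resolvent[OF A_hurwitz gamma_invertible gamma_lyapunov, of lam j]
    by (simp add: g_def D_def b_def W_def G_def recursion_simps(5))
  have W1: "W (Suc 0) = cm Th ** cadj (cm C) ** cm C ** cm Th"
    by (simp add: W_def forcing_simps PiC_def cm_mult cm_transpose matrix_mul_assoc)
  have WSS: "W (Suc (Suc j)) = g (Suc j) ** b j ** g (Suc j)" for j
    by (simp add: W_def g_def b_def forcing_simps cm_mult)
  have E0: "E 0 = cm Th" and ES: "E (Suc j) = g (Suc j) ** b j ** G ** E j" for j
    by (simp_all add: E_def a_def g_def b_def recursion_simps(2,4) cm_mult)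
  have Es0: "Es 0 = cm Th" and EsS: "Es (Suc j) = Es j ** cadj G ** b j ** g (Suc j)" for j
    by (simp_all add: Es_def)
  \<comment> \<open>The exponent \<open>k\<close> is generalised because each descent by one level
    raises it by one; the sum \<open>k + j\<close> is the invariant.\<close>
  have pow: "Es j ** D j ** mpow (W (Suc j) ** D j) k ** E j =
      cm Th ** D 0 ** mpow (W (Suc 0) ** D 0) (k + j) ** cm Th" for k
  proof (induction j arbitrary: k)
    case 0
    then show ?case by (simp add: E0 Es0)
  next
    case (Suc j)
    have "Es (Suc j) ** D (Suc j) ** mpow (W (Suc (Suc j)) ** D (Suc j)) k ** E (Suc j) =
        Es j ** ((cadj G ** b j ** g (Suc j)) ** D (Suc j)
          ** mpow (g (Suc j) ** b j ** g (Suc j) ** D (Suc j)) k ** (g (Suc j) ** b j ** G)) ** E j"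
      by (simp add: ES EsS WSS matrix_mul_assoc)
    also have "\<dots> = Es j ** D j ** mpow (W (Suc j) ** D j) (Suc k) ** E j"
      unfolding nested_power_step[OF gDg] by (simp add: D_def matrix_mul_assoc)
    finally show ?case using Suc.IH[of "Suc k"] by simp
  qed
  have cadjE: "cadj (E j) = (-1) ^ Suc j *\<^sub>R Es j"
  proof (induction j)
    case 0
    then show ?case by (simp add: E0 Es0 Th_antisym cm_minus flip: cm_transpose)
  next
    case (Suc j)
    have "cadj (E (Suc j)) = cadj (E j) ** cadj G ** cm (transpose (alpha A Th B C (Suc (Suc j))))"
      by (simp add: E_def a_def cadj_mult cm_transpose matrix_mul_assoc)
    also have "\<dots> = - (cadj (E j) ** cadj G ** b j ** g (Suc j))"
      by (simp add: alpha_transpose cm_minus cm_mult b_def g_def matrix_mult_minus_right matrix_mul_assoc)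
    also have "\<dots> = (-1) ^ Suc (Suc j) *\<^sub>R Es (Suc j)"
      by (simp add: Suc.IH EsS matrix_mult_minus_left flip: scalar_matrix_assoc)
    finally show ?case .
  qed
  let ?X = "cm C ** cm Th ** D 0" and ?Z = "cm Th ** cadj (cm C)"
  \<comment> \<open>The resolvent identity at level 0 factors \<open>Psi\<close> as
    \<open>?X ** ?Z\<close>, while the reversed product \<open>?Z ** ?X\<close> is
    \<open>W (Suc 0) ** D 0\<close>, the matrix whose powers \<open>pow\<close> produces.\<close>
  have "Psi A B C lam = cm C ** (G ** W 0 ** cadj G) ** cadj (cm C)"
    by (simp add: Psi_def Ffun_def G_def W_def forcing_simps mho_def cm_mult cm_transpose cadj_mult matrix_mul_assoc)
  also have "\<dots> = ?X ** ?Z"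
    by (simp add: gDg[symmetric] g_def recursion_simps(1) matrix_mul_assoc)
  finally have Psi: "Psi A B C lam = ?X ** ?Z" .
  have "cadj (G ** E j ** cadj (cm C)) ** b j ** (G ** E j ** cadj (cm C)) =
      cm C ** cadj (E j) ** cadj G ** b j ** G ** E j ** cadj (cm C)"
    by (simp add: cadj_mult cadj_cadj matrix_mul_assoc)
  also have "\<dots> = (-1) ^ Suc j *\<^sub>R (cm C ** (Es j ** D j ** mpow (W (Suc j) ** D j) 0 ** E j) ** cadj (cm C))"
    by (simp add: cadjE D_def matrix_mul_assoc matrix_scalar_ac matrix_mult_minus_left
        matrix_mult_minus_right flip: scalar_matrix_assoc)
  also have "cm C ** (Es j ** D j ** mpow (W (Suc j) ** D j) 0 ** E j) ** cadj (cm C) =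
      ?X ** (mpow (?Z ** ?X) j ** ?Z)"
    unfolding pow W1 by (simp add: matrix_mul_assoc)
  also have "\<dots> = mpow (Psi A B C lam) (Suc j)"
    unfolding mpow_sandwich Psi by (simp add: matrix_mul_assoc)
  finally show ?thesis by (simp add: b_def E_def)
qed

end

section \<open>The sequence space\<close>

lemma cinner_mult_left: "cinner (M *v u) v = cinner u (cadj M *v v)"
proof -
  have "cinner (M *v u) v = (\<Sum>i\<in>UNIV. \<Sum>j\<in>UNIV. M $ i $ j * u $ j * cnj (v $ i))"
    by (simp add: cinner_def matrix_vector_mult_def sum_distrib_right)
  also have "\<dots> = (\<Sum>j\<in>UNIV. \<Sum>i\<in>UNIV. M $ i $ j * u $ j * cnj (v $ i))"
    by (rule sum.swap)
  also have "\<dots> = cinner u (cadj M *v v)"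
    by (simp add: cinner_def matrix_vector_mult_def cadj_def sum_distrib_left mult_ac)
  finally show ?thesis .
qed

lemma cinner_add_left: "cinner (u + v) w = cinner u w + cinner v w"
  by (simp add: cinner_def sum.distrib algebra_simps)

lemma cinner_add_right: "cinner w (u + v) = cinner w u + cinner w v"
  by (simp add: cinner_def sum.distrib algebra_simps)

lemma cinner_diff_left: "cinner (u - v) w = cinner u w - cinner v w"
  by (simp add: cinner_def sum_subtractf algebra_simps)

lemma cinner_diff_right: "cinner w (u - v) = cinner w u - cinner w v"
  by (simp add: cinner_def sum_subtractf algebra_simps)

lemma cinner_scale_left: "cinner (c *s u) v = c * cinner u v"
  by (simp add: cinner_def sum_distrib_left mult_ac)

lemma cinner_scale_right: "cinner u (c *s v) = cnj c * cinner u v"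
  by (simp add: cinner_def sum_distrib_left mult_ac)

lemma cinner_scaleR_left: "cinner (c *\<^sub>R u) v = c * cinner u v"
  by (simp add: cinner_def sum_distrib_left mult_ac scaleR_conv_of_real[where 'a=complex])

lemma cinner_zero [simp]: "cinner 0 v = 0" "cinner v 0 = 0"
  by (simp_all add: cinner_def)

lemma cinner_axis_left: "cinner (axis j 1) v = cnj (v $ j)"
  by (simp add: cinner_def axis_def if_distrib if_distribR cong: if_cong)

text \<open>A weak form of Cauchy-Schwarz, enough both for summability of \<open>l2inner\<close> and
  for boundary terms to vanish.\<close>

lemma norm_cinner_le: "norm (cinner u v) \<le> (norm u)\<^sup>2 + (norm v)\<^sup>2"
proof -
  have "norm (cinner u v) \<le> (\<Sum>i\<in>UNIV. norm (u $ i) * norm (v $ i))"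
    unfolding cinner_def by (rule order.trans[OF norm_sum]) (simp add: norm_mult)
  also have "\<dots> \<le> (\<Sum>i\<in>UNIV. (norm (u $ i))\<^sup>2 + (norm (v $ i))\<^sup>2)"
  proof (rule sum_mono)
    fix i
    show "norm (u $ i) * norm (v $ i) \<le> (norm (u $ i))\<^sup>2 + (norm (v $ i))\<^sup>2"
      using sum_squares_bound[of "norm (u $ i)" "norm (v $ i)"]
        mult_nonneg_nonneg[of "norm (u $ i)" "norm (v $ i)"]
      by (simp add: mult.assoc del: mult_nonneg_nonneg)
  qed
  also have "\<dots> = (norm u)\<^sup>2 + (norm v)\<^sup>2"
    by (simp add: norm_vec_def L2_set_def sum.distrib sum_nonneg)
  finally show ?thesis .
qed

lemma l2inner_sums:
  assumes "x \<in> l2X" "y \<in> l2X"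
  shows "(\<lambda>k. cinner (x k) (y k)) sums l2inner x y"
  unfolding l2inner_def
proof (rule summable_sums, rule summable_comparison_test')
  show "summable (\<lambda>k. (norm (x k))\<^sup>2 + (norm (y k))\<^sup>2)"
    using assms by (intro summable_add) (simp_all add: l2X_def)
qed (rule norm_cinner_le)

lemma l2X_tendsto_zero:
  assumes "x \<in> l2X"
  shows "x \<longlonglongrightarrow> 0"
proof -
  have "(\<lambda>k. (norm (x k))\<^sup>2) \<longlonglongrightarrow> 0"
    using assms unfolding l2X_def by (intro summable_LIMSEQ_zero) simp
  then have "(\<lambda>k. sqrt ((norm (x k))\<^sup>2)) \<longlonglongrightarrow> sqrt 0"
    by (rule tendsto_real_sqrt)
  then show ?thesis by (simp add: tendsto_norm_zero_iff)
qed

lemma single_in_l2X: "(\<lambda>k. if k = n then v else 0) \<in> l2X"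
proof -
  have "(\<lambda>k. (norm (if k = n then v else 0))\<^sup>2) = (\<lambda>k. if k = n then (norm v)\<^sup>2 else 0)"
    by auto
  then show ?thesis by (simp add: l2X_def)
qed

lemma l2inner_single_left: "l2inner (\<lambda>k. if k = n then v else 0) y = cinner v (y n)"
proof -
  have "(\<lambda>k. cinner (if k = n then v else 0) (y k)) = (\<lambda>k. if k = n then cinner v (y k) else 0)"
    by auto
  then show ?thesis
    unfolding l2inner_def using sums_single[of n "\<lambda>k. cinner v (y k)"] by (simp add: sums_iff)
qed

lemma l2inner_single_right: "l2inner y (\<lambda>k. if k = n then v else 0) = cinner (y n) v"
proof -
  have "(\<lambda>k. cinner (y k) (if k = n then v else 0)) = (\<lambda>k. if k = n then cinner (y k) v else 0)"
    by auto
  then show ?thesis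
    unfolding l2inner_def using sums_single[of n "\<lambda>k. cinner (y k) v"] by (simp add: sums_iff)
qed

text \<open>Testing against unit vectors placed in a single component recovers every entry.\<close>

lemma l2inner_ext:
  assumes "\<And>z. z \<in> l2X \<Longrightarrow> l2inner z x = l2inner z y"
  shows "x = y"
proof (rule ext)
  fix k
  have "cinner (axis j 1) (x k) = cinner (axis j 1) (y k)" for j
    using assms[OF single_in_l2X[of k "axis j 1"]] by (simp add: l2inner_single_left)
  then show "x k = y k" by (simp add: cinner_axis_left vec_eq_iff)
qed

section \<open>Adjoints of the input, feedback and state operators\<close>

lemma opB_single: "opB B v = (\<lambda>k. if k = 0 then (cm B ** Smat) *v v else 0)"
  by (simp add: opB_def)

lemma opB_in_l2X: "opB B v \<in> l2X"
  unfolding opB_single by (rule single_in_l2X)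

lemma l2inner_opB_right: "l2inner y (opB B v) = cinner (opBadj B y) v"
  unfolding opB_single by (simp add: l2inner_single_right opBadj_def cinner_mult_left cadj_cadj)

lemma l2inner_opB_left: "l2inner (opB B v) y = cinner v (opBadj B y)"
  unfolding opB_single by (simp add: l2inner_single_left opBadj_def cinner_mult_left)

text \<open>Self-adjointness of \<open>Q\<close> makes the right-hand side a representing element,
  and \<open>l2inner_ext\<close> makes it the only one, so the definite description in
  \<open>ladj\<close> is resolved.\<close>

lemma ladj_feedback:
  assumes "bdd_selfadjoint Q"
  shows "ladj (\<lambda>z. opBadj B (Q z)) v = Q (opB B v)"
  unfolding ladj_def
proof (rule the_equality)
  have Q: "Q z \<in> l2X" if "z \<in> l2X" for z
    using assms that by (auto simp: bdd_selfadjoint_def bounded_op_def)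
  have eq: "cinner (opBadj B (Q y)) v = l2inner y (Q (opB B v))" if "y \<in> l2X" for y
  proof -
    have "l2inner (Q y) (opB B v) = l2inner y (Q (opB B v))"
      using assms that opB_in_l2X[of B v] unfolding bdd_selfadjoint_def by blast
    then show ?thesis by (simp only: l2inner_opB_right)
  qed
  then show "Q (opB B v) \<in> l2X \<and> (\<forall>y\<in>l2X. cinner (opBadj B (Q y)) v = l2inner y (Q (opB B v)))"
    using Q opB_in_l2X by blast
  fix x
  assume "x \<in> l2X \<and> (\<forall>y\<in>l2X. cinner (opBadj B (Q y)) v = l2inner y x)"
  then show "x = Q (opB B v)"
    using eq by (intro l2inner_ext) simp
qed

text \<open>The partial sums of both sides differ by a boundary term that tends to 0.\<close>

lemma opAT_adjoint_sums:
  assumes bdd: "bounded_op l2X l2norm l2X l2norm (opA A Th B C)"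
    and x: "x \<in> l2X" and y: "y \<in> l2X"
  shows "(\<lambda>k. cinner (opAT A Th B C y k) (x k)) sums l2inner y (opA A Th B C x)"
proof -
  let ?A = "opA A Th B C x" and ?T = "opAT A Th B C y"
  \<comment> \<open>The subdiagonal part of row k+1 of \<open>opA\<close>. Through the transposed
    block, column k of the adjoint pairs it with \<open>y (Suc k)\<close>, one index beyond the
    partial sum.\<close>
  define e where "e k = ?A (Suc k) - cm A *v x (Suc k)" for k
  have Ax: "?A \<in> l2X"
    using bdd x by (auto simp: bounded_op_def)
  have e: "e = (\<lambda>k. if k = 0 then cm (alpha A Th B C 1 ** PiC C) *v x 0
      else cm (alpha A Th B C (Suc k)) *v x k)"
    by (auto simp: e_def opA_def)
  have ady: "cinner (cm (transpose M) *v u) v = cinner u (cm M *v v)" for M u v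
    by (simp add: cm_transpose cinner_mult_left cadj_cadj)
  have partial: "(\<Sum>k<Suc n. cinner (?T k) (x k)) =
      (\<Sum>k<Suc n. cinner (y k) (?A k)) + cinner (y (Suc n)) (e n)" for n
  proof (induction n)
    case 0
    show ?case by (simp add: opAT_def e opA_def cinner_add_left ady)
  next
    case (Suc n)
    have T: "cinner (?T (Suc n)) (x (Suc n)) =
        cinner (y (Suc n)) (cm A *v x (Suc n)) + cinner (y (Suc (Suc n))) (e (Suc n))"
      by (simp add: opAT_def e cinner_add_left ady)
    have "cm A *v x (Suc n) = ?A (Suc n) - e n"
      by (simp add: e_def)
    then show ?case
      unfolding sum.lessThan_Suc[of _ "Suc n"] Suc.IH T by (simp add: cinner_diff_right)
  qed
  note lims = LIMSEQ_Suc[OF l2X_tendsto_zero[OF x]] LIMSEQ_Suc[OF l2X_tendsto_zero[OF y]]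
    LIMSEQ_Suc[OF l2X_tendsto_zero[OF Ax]]
  \<comment> \<open>The subdiagonal part vanishes in the limit as a difference of components of two
    square-summable sequences; no uniform bound on the blocks \<open>alpha\<close> enters.\<close>
  have "(\<lambda>n. ?A (Suc n) - cm A *v x (Suc n)) \<longlonglongrightarrow> 0 - cm A *v 0"
    by (intro tendsto_diff bounded_linear.tendsto[OF matrix_vector_mul_bounded_linear] lims)
  then have "e \<longlonglongrightarrow> 0"
    by (simp add: e_def[abs_def])
  note lims(2) this
  then have "(\<lambda>n. (norm (y (Suc n)))\<^sup>2 + (norm (e n))\<^sup>2) \<longlonglongrightarrow> 0\<^sup>2 + 0\<^sup>2"
    by (intro tendsto_add tendsto_power tendsto_norm_zero)
  then have "(\<lambda>n. cinner (y (Suc n)) (e n)) \<longlonglongrightarrow> 0"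
    using Lim_null_comparison[of "\<lambda>n. cinner (y (Suc n)) (e n)"
        "\<lambda>n. (norm (y (Suc n)))\<^sup>2 + (norm (e n))\<^sup>2" sequentially]
    by (simp only: norm_cinner_le eventually_True power_zero_numeral add_0_right)
  moreover have "(\<lambda>n. \<Sum>k<Suc n. cinner (y k) (?A k)) \<longlonglongrightarrow> l2inner y ?A"
    using l2inner_sums[OF y Ax] unfolding sums_def by (rule LIMSEQ_Suc)
  ultimately have "(\<lambda>n. \<Sum>k<Suc n. cinner (?T k) (x k)) \<longlonglongrightarrow> l2inner y ?A + 0"
    unfolding partial by (intro tendsto_add)
  then show ?thesis
    unfolding sums_def add_0_right by (rule LIMSEQ_imp_Suc)
qed

section \<open>Spectral factorization\<close>

text \<open>\<open>Jm\<close> is real and antisymmetric, so \<i> times it is Hermitian.\<close>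

lemma cadj_Smat: "cadj Smat = (Smat :: complex^('k::finite \<times> 2)^('k \<times> 2))"
proof -
  have J: "Jm $ q $ p = - Jm $ p $ q" for p q :: "'k \<times> 2"
    by (simp add: Jm_def Jbold_def)
  have "cadj Smat $ p $ q = Smat $ p $ q" for p q :: "'k \<times> 2"
    using J[of q p]
    by (simp add: cadj_def Smat_def Omega_def transpose_def csmul_def cm_def mat_def)
  then show ?thesis by (simp add: vec_eq_iff)
qed

lemma mult_axis_component: "(M *v axis j 1) $ i = (M :: 'a::semiring_1^'m^'n) $ i $ j"
  by (simp add: matrix_vector_mult_def axis_def if_distrib if_distribR cong: if_cong)

lemma axis_component: "axis j c $ i = (if i = j then c else 0)"
  by (simp add: axis_def)

lemma cinner_axis_right: "cinner v (axis j 1) = v $ j"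
  by (simp add: cinner_def axis_def if_distrib if_distribR cong: if_cong)

lemma csmul_mult_vec: "csmul c M *v v = c *s (M *v v)"
  by (simp add: csmul_def matrix_vector_mult_def vec_eq_iff sum_distrib_left mult_ac)

lemma scaleR_mult_vec: "(c *\<^sub>R M) *v v = c *\<^sub>R (M *v (v :: complex^'n))"
  by (simp add: matrix_vector_mult_def vec_eq_iff scaleR_sum_right)

text \<open>For fixed vectors the form is linear in the matrix, hence continuous in finite
  dimension, and passes through the series.\<close>

lemma phi_mat_cinner_sums:
  "(\<lambda>k. c ^ k / fact (Suc k) * cinner (mpow M k *v u) v) sums cinner (phi_mat (csmul c M) *v u) v"
proof -
  have "summable (\<lambda>k. (1 / fact (k + 1)) *\<^sub>R mpow (csmul c M) k)"
    by (rule summable_mpow_series) (simp add: divide_simps fact_mono)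
  then have "(\<lambda>k. (1 / fact (k + 1)) *\<^sub>R mpow (csmul c M) k) sums phi_mat (csmul c M)"
    unfolding phi_mat_def by (rule summable_sums)
  moreover have "linear (\<lambda>X. cinner (X *v u) v)"
    by (rule linearI)
       (simp_all add: matrix_vector_mult_add_rdistrib cinner_add_left cinner_scaleR_left
         scaleR_conv_of_real[where 'a=complex] scaleR_mult_vec)
  then have "bounded_linear (\<lambda>X. cinner (X *v u) v)"
    by (simp add: linear_linear)
  ultimately have "(\<lambda>k. cinner (((1 / fact (k + 1)) *\<^sub>R mpow (csmul c M) k) *v u) v) sums
      cinner (phi_mat (csmul c M) *v u) v"
    by (rule bounded_linear.sums[rotated])
  moreover have "cinner (((1 / fact (k + 1)) *\<^sub>R mpow (csmul c M) k) *v u) v =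
      c ^ k / fact (Suc k) * cinner (mpow M k *v u) v" for k
    by (simp add: mpow_csmul csmul_mult_vec cinner_scaleR_left cinner_scale_left scaleR_mult_vec
        del: fact_Suc)
  ultimately show ?thesis by simp
qed

section \<open>States driven by an input at an imaginary frequency\<close>

context nonsingular_recursion
begin

context
  fixes lam :: real and G :: "complex^'n^'n" and a :: "nat \<Rightarrow> complex^'n^'n"
  defines "G \<equiv> matrix_inv (mat (\<i> * lam) - cm A)"
    and "a \<equiv> \<lambda>j. cm (alpha A Th B C (Suc j))"
begin

lemma resolvent_solve:
  assumes "(\<i> * lam) *s w - cm A *v w = q"
  shows "w = G *v q"
proof -
  let ?R = "mat (\<i> * lam) - cm A"
  have "mat (\<i> * lam) *v w = (\<i> * lam) *s w"
    by (simp add: matrix_vector_mult_def mat_def vec_eq_iff if_distrib if_distribR cong: if_cong)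
  then have "?R *v w = q"
    using assms by (simp add: matrix_vector_mult_diff_rdistrib)
  moreover have "G ** ?R = mat 1"
    unfolding G_def by (intro matrix_inv_left resolvent_invertible A_hurwitz) simp
  ultimately show ?thesis
    by (metis matrix_vector_mul_assoc matrix_vector_mul_lid)
qed

text \<open>The assumption says that \<open>z\<close> solves the resolvent equation of
  \<open>opA\<close> with input \<open>u\<close>. The operator is block lower bidiagonal, so forward
  substitution determines all components.\<close>

lemma state_components:
  assumes "opA A Th B C z = (\<lambda>k. (\<i> * lam) *s z k - opB B u k)"
  shows "cm C *v z 0 = (Ffun A B C (\<i> * lam) ** Smat) *v u"
    and "z (Suc j) = (G ** chain G a j ** cadj (cm C)) *v (cm C *v z 0)"
proof -
  have z: "(\<i> * lam) *s z k - opA A Th B C z k = opB B u k" for k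
    by (simp add: assms)
  have "z 0 = G *v ((cm B ** Smat) *v u)"
    using z[of 0] by (intro resolvent_solve) (simp add: opA_def opB_def)
  then show "cm C *v z 0 = (Ffun A B C (\<i> * lam) ** Smat) *v u"
    by (simp add: Ffun_def G_def matrix_vector_mul_assoc matrix_mul_assoc)
  show "z (Suc j) = (G ** chain G a j ** cadj (cm C)) *v (cm C *v z 0)"
  proof (induction j)
    case 0
    have "z (Suc 0) = G *v (cm (alpha A Th B C 1 ** PiC C) *v z 0)"
      using z[of 1] by (intro resolvent_solve) (simp add: opA_def opB_def algebra_simps)
    then show ?case
      by (simp add: a_def PiC_def cm_mult cm_transpose matrix_vector_mul_assoc matrix_mul_assoc)
  next
    case (Suc j)
    have "z (Suc (Suc j)) = G *v (a (Suc j) *v z (Suc j))"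
      using z[of "Suc (Suc j)"]
      by (intro resolvent_solve) (simp add: opA_def opB_def a_def algebra_simps)
    then show ?case
      unfolding Suc.IH by (simp add: matrix_vector_mul_assoc matrix_mul_assoc)
  qed
qed

text \<open>By \<open>chain_power\<close> the summand of index k is the k-th term of the series for
  \<open>phi_mat\<close>. Two states are used instead of one so that single matrix entries can be
  read off later.\<close>

lemma output_form_sums:
  assumes z: "opA A Th B C z = (\<lambda>k. (\<i> * lam) *s z k - opB B u k)"
    and z': "opA A Th B C z' = (\<lambda>k. (\<i> * lam) *s z' k - opB B u' k)"
  shows "(\<lambda>k. cinner (opCT C (opH A Th B C th (opC C z)) k) (z' k)) sums
    cinner (Sigma A B C th lam *v u) u'"
proof -
  define y where "y = cm C *v z 0"
  define y' where "y' = cm C *v z' 0"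
  let ?F = "Ffun A B C (\<i> * lam) ** Smat"
  have "cinner (opCT C (opH A Th B C th (opC C z)) k) (z' k) =
      (2 * \<i> * th) ^ k / fact (Suc k) * cinner (mpow (Psi A B C lam) k *v y) y'" for k
  proof (cases k)
    case 0
    then show ?thesis
      by (simp add: opCT_def opH_def opC_def y_def y'_def cm_transpose cinner_mult_left cadj_cadj)
  next
    case (Suc j)
    let ?X = "G ** chain G a j ** cadj (cm C)"
    have "cinner (cm (beta A Th B C (Suc j)) *v z (Suc j)) (z' (Suc j)) =
        cinner ((cadj ?X ** cm (beta A Th B C (Suc j)) ** ?X) *v y) y'"
      unfolding state_components(2)[OF z] state_components(2)[OF z'] y_def[symmetric] y'_def[symmetric]
      by (simp add: cinner_mult_left cadj_mult cadj_cadj matrix_vector_mul_assoc matrix_mul_assoc)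
    also have "\<dots> = (-1) ^ Suc j * cinner (mpow (Psi A B C lam) (Suc j) *v y) y'"
      unfolding G_def a_def chain_power
      by (simp only: scaleR_mult_vec cinner_scaleR_left of_real_power of_real_minus of_real_1)
    finally have "cinner (cm (beta A Th B C (Suc j)) *v z (Suc j)) (z' (Suc j)) =
      (-1) ^ Suc j * cinner (mpow (Psi A B C lam) (Suc j) *v y) y'" .
    \<comment> \<open>The sign built into the weights of \<open>opH\<close> cancels the one from
      \<open>chain_power\<close>. The weight \<open>1 / fact (j + 2)\<close> at position j is the
      coefficient of index \<open>k = Suc j\<close>.\<close>
    moreover have "(- 2 * \<i> * complex_of_real th) ^ Suc j * (-1) ^ Suc j = (2 * \<i> * th) ^ Suc j"
      by (simp only: power_mult_distrib[symmetric]) simp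
    ultimately show ?thesis
      using Suc
      by (simp add: opCT_def opH_def opC_def cinner_scale_left del: fact_Suc power_Suc mpow.simps)
  qed
  then have "(\<lambda>k. cinner (opCT C (opH A Th B C th (opC C z)) k) (z' k)) sums
      cinner (phi_mat (csmul (2 * \<i> * th) (Psi A B C lam)) *v y) y'"
    using phi_mat_cinner_sums[of "2 * \<i> * th" "Psi A B C lam" y y'] by (simp only:)
  moreover have "y = ?F *v u" "y' = ?F *v u'"
    unfolding y_def y'_def by (rule state_components(1)[OF z] state_components(1)[OF z'])+
  then have "cinner (phi_mat (csmul (2 * \<i> * th) (Psi A B C lam)) *v y) y' =
      cinner (Sigma A B C th lam *v u) u'"
    by (simp add: Sigma_def cinner_mult_left cadj_mult cadj_Smat cadj_cadj matrix_vector_mul_assoc matrix_mul_assoc)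
  ultimately show ?thesis by simp
qed

end

text \<open>Pairing the Riccati equation at \<open>z\<close> with \<open>z'\<close> and inserting
  both state equations leaves only input terms: the multiples of \<open>l2inner (Q z) z'\<close>
  carry the conjugate factors \<open>cnj ?s\<close> and \<open>?s\<close>, which add up to 0 on the
  imaginary axis.\<close>

lemma riccati_dissipation:
  fixes lam th :: real and Q :: "(nat \<Rightarrow> complex^'n) \<Rightarrow> nat \<Rightarrow> complex^'n"
  defines "L \<equiv> \<lambda>z. opBadj B (Q z)"
  assumes A_bdd: "bounded_op l2X l2norm l2X l2norm (opA A Th B C)"
    and Q_sa: "bdd_selfadjoint Q"
    and riccati: "\<And>x. x \<in> l2X \<Longrightarrow>
        (\<lambda>k. opAT A Th B C (Q x) k + Q (opA A Th B C x) k
              + complex_of_real th *s opCT C (opH A Th B C th (opC C x)) k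
              + ladj L (L x) k) = (\<lambda>k. 0)"
    and zX: "z \<in> l2X" and zX': "z' \<in> l2X"
    and z: "opA A Th B C z = (\<lambda>k. (\<i> * lam) *s z k - opB B u k)"
    and z': "opA A Th B C z' = (\<lambda>k. (\<i> * lam) *s z' k - opB B u' k)"
  shows "th * cinner (Sigma A B C th lam *v u) u' =
    cinner (L z) u' + cinner u (L z') - cinner (L z) (L z')"
proof -
  let ?A = "opA A Th B C" and ?s = "\<i> * complex_of_real lam"
  have QX: "Q x \<in> l2X" if "x \<in> l2X" for x
    using Q_sa that by (auto simp: bdd_selfadjoint_def bounded_op_def)
  have sa: "l2inner (Q x) y = l2inner x (Q y)" if "x \<in> l2X" "y \<in> l2X" for x y
    using Q_sa that by (auto simp: bdd_selfadjoint_def)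
  have AX: "?A x \<in> l2X" if "x \<in> l2X" for x
    using A_bdd that by (auto simp: bounded_op_def)
  \<comment> \<open>The four series converge separately, while the Riccati equation makes their sum
    vanish in every component.\<close>
  have "(\<lambda>k. cinner (opAT A Th B C (Q z) k) (z' k) + cinner (Q (?A z) k) (z' k)
        + th * cinner (opCT C (opH A Th B C th (opC C z)) k) (z' k)
        + cinner (Q (opB B (L z)) k) (z' k)) sums
      (l2inner (Q z) (?A z') + l2inner (Q (?A z)) z'
        + th * cinner (Sigma A B C th lam *v u) u' + l2inner (Q (opB B (L z))) z')"
    by (intro sums_add sums_mult opAT_adjoint_sums[OF A_bdd zX' QX[OF zX]] output_form_sums[OF z z']
        l2inner_sums QX AX opB_in_l2X zX zX')
  moreover have "cinner (opAT A Th B C (Q z) k) (z' k) + cinner (Q (?A z) k) (z' k)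
        + th * cinner (opCT C (opH A Th B C th (opC C z)) k) (z' k)
        + cinner (Q (opB B (L z)) k) (z' k) = 0" for k
    using fun_cong[OF riccati[OF zX], of k] ladj_feedback[OF Q_sa, of B "L z"]
    by (simp add: L_def flip: cinner_add_left cinner_scale_left)
  ultimately have "l2inner (Q z) (?A z') + l2inner (Q (?A z)) z'
        + th * cinner (Sigma A B C th lam *v u) u' + l2inner (Q (opB B (L z))) z' = 0"
    by (simp only: sums_unique2[OF _ sums_zero])
  moreover have "l2inner (Q (opB B (L z))) z' = cinner (L z) (L z')"
    by (simp add: sa[OF opB_in_l2X zX'] l2inner_opB_left L_def)
  moreover have "l2inner (Q z) (?A z') = - ?s * l2inner (Q z) z' - cinner (L z) u'"
  proof -
    have "(\<lambda>k. cnj ?s * cinner (Q z k) (z' k) - cinner (Q z k) (opB B u' k)) sums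
        (cnj ?s * l2inner (Q z) z' - l2inner (Q z) (opB B u'))"
      by (intro sums_diff sums_mult l2inner_sums QX zX zX' opB_in_l2X)
    moreover have "(\<lambda>k. cnj ?s * cinner (Q z k) (z' k) - cinner (Q z k) (opB B u' k)) sums
        l2inner (Q z) (?A z')"
      using l2inner_sums[OF QX[OF zX] AX[OF zX']]
      by (simp only: z' cinner_diff_right cinner_scale_right)
    ultimately have "l2inner (Q z) (?A z') = cnj ?s * l2inner (Q z) z' - l2inner (Q z) (opB B u')"
      by (rule sums_unique2[symmetric])
    then show ?thesis by (simp add: l2inner_opB_right L_def)
  qed
  moreover have "l2inner (Q (?A z)) z' = ?s * l2inner (Q z) z' - cinner u (L z')"
  proof -
    have "(\<lambda>k. ?s * cinner (z k) (Q z' k) - cinner (opB B u k) (Q z' k)) sums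
        (?s * l2inner z (Q z') - l2inner (opB B u) (Q z'))"
      by (intro sums_diff sums_mult l2inner_sums QX zX zX' opB_in_l2X)
    moreover have "(\<lambda>k. ?s * cinner (z k) (Q z' k) - cinner (opB B u k) (Q z' k)) sums
        l2inner (?A z) (Q z')"
      using l2inner_sums[OF AX[OF zX] QX[OF zX']]
      by (simp only: z cinner_diff_left cinner_scale_left)
    ultimately have "l2inner (?A z) (Q z') = ?s * l2inner z (Q z') - l2inner (opB B u) (Q z')"
      by (rule sums_unique2[symmetric])
    then show ?thesis by (simp add: sa AX zX zX' l2inner_opB_left L_def)
  qed
  ultimately show ?thesis by (simp add: algebra_simps)
qed

end

theorem theorem7p7:
  fixes A Th :: "real^'n^'n" and B :: "real^('k::finite \<times> 2)^'n" and C :: "real^'n^'r"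
    and th :: real and Q :: "(nat \<Rightarrow> complex^'n) \<Rightarrow> (nat \<Rightarrow> complex^'n)"
  assumes N_even: "even CARD('n)"
    and Th_antisym: "transpose Th = - Th"
    and Th_nonsing: "det Th \<noteq> 0"
    and A_hurwitz: "hurwitz A"
    and lyap: "A ** Th + Th ** transpose A + mho B = 0"
    and th_pos: "th > 0"
    and gamma_nonsing: "\<And>k. k \<ge> 1 \<Longrightarrow> det (gamma A Th B C k) \<noteq> 0"
    and A_bdd: "bounded_op l2X l2norm l2X l2norm (opA A Th B C)"
    and B_bdd: "bounded_op UNIV norm l2X l2norm (opB B)"
    and C_bdd: "bounded_op l2X l2norm l2Y l2Ynorm (opC C)"
    and H_bdd: "bounded_op l2Y l2Ynorm l2Y l2Ynorm (opH A Th B C th)"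
    and resolvent_A: "\<And>s. Re s \<ge> 0 \<Longrightarrow> bdd_invertible (shiftI s (opA A Th B C))"
    and Q_sa: "bdd_selfadjoint Q"
    and riccati: "\<And>x. x \<in> l2X \<Longrightarrow>
        (\<lambda>k. opAT A Th B C (Q x) k + Q (opA A Th B C x) k
              + complex_of_real th *s opCT C (opH A Th B C th (opC C x)) k
              + ladj (\<lambda>z. opBadj B (Q z)) (opBadj B (Q x)) k) = (\<lambda>k. 0)"
    and stabilizing: "spectrum_l2 (\<lambda>x k. opA A Th B C x k + opB B (opBadj B (Q x)) k)
                        \<subseteq> {s. Re s < 0}"
  shows "\<forall>lam::real.
           invertible (Gtf A Th B C (\<lambda>z. opBadj B (Q z)) (\<i> * complex_of_real lam)) \<and>
           invertible (Delta A B C th lam) \<and>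
           matrix_inv (Delta A B C th lam) =
             Gtf A Th B C (\<lambda>z. opBadj B (Q z)) (\<i> * complex_of_real lam)
             ** cadj (Gtf A Th B C (\<lambda>z. opBadj B (Q z)) (\<i> * complex_of_real lam))"
proof (intro allI)
  fix lam :: real
  interpret nonsingular_recursion A Th B C
    by unfold_locales (fact Th_antisym Th_nonsing A_hurwitz lyap gamma_nonsing)+
  let ?s = "\<i> * complex_of_real lam" and ?D = "Delta A B C th lam"
  define L where "L = (\<lambda>z. opBadj B (Q z))"
  define K where "K = Gtf A Th B C L ?s"
  define T where "T = shiftI ?s (\<lambda>x k. opA A Th B C x k + opB B (L x) k)"
  define z where "z j = inv_into l2X T (opB B (axis j 1))" for j
  \<comment> \<open>The imaginary axis lies outside the open left half-plane, hence outside the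
    spectrum of the closed loop.\<close>
  have "bdd_invertible T"
    using stabilizing by (force simp: spectrum_l2_def T_def L_def)
  then have T: "T ` l2X = l2X"
    by (simp add: bdd_invertible_def bij_betw_def)
  have zX: "z j \<in> l2X" and Tz: "T (z j) = opB B (axis j 1)" for j
    using inv_into_into[of "opB B (axis j 1)" T l2X] f_inv_into_f[of "opB B (axis j 1)" T l2X]
      opB_in_l2X[of B "axis j 1"]
    by (simp_all add: T z_def)
  have K: "K *v axis j 1 = axis j 1 + L (z j)" for j
    unfolding vec_eq_iff
    by (simp add: mult_axis_component axis_component K_def Gtf_def T_def z_def mat_def)
  \<comment> \<open>The feedback is absorbed into the input: column j of \<open>K\<close> is the
    j-th unit vector plus \<open>L (z j)\<close>, so the closed-loop state is an open-loop state
    driven by that column.\<close>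
  have Az: "opA A Th B C (z j) = (\<lambda>k. ?s *s z j k - opB B (K *v axis j 1) k)" for j
  proof
    fix k
    have "?s *s z j k - (opA A Th B C (z j) k + opB B (L (z j)) k) = opB B (axis j 1) k"
      using fun_cong[OF Tz[of j], of k] by (simp add: T_def shiftI_def)
    moreover have "opB B (K *v axis j 1) k = opB B (axis j 1) k + opB B (L (z j)) k"
      by (simp add: K opB_def matrix_vector_right_distrib)
    ultimately show "opA A Th B C (z j) k = ?s *s z j k - opB B (K *v axis j 1) k"
      by (simp add: algebra_simps)
  qed
  have "(cadj K ** ?D ** K) $ i $ j = mat 1 $ i $ j" for i j
  proof -
    let ?u = "K *v axis j 1" and ?u' = "K *v axis i 1"
    have "th * cinner (Sigma A B C th lam *v ?u) ?u' =
        cinner (L (z j)) ?u' + cinner ?u (L (z i)) - cinner (L (z j)) (L (z i))"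
      unfolding L_def
      by (rule riccati_dissipation[OF A_bdd Q_sa riccati zX zX Az Az])
    \<comment> \<open>Completing the square with \<open>L (z j) = ?u - axis j 1\<close>, and
      likewise for index i.\<close>
    also have "\<dots> = cinner ?u ?u' - cinner (axis j 1) (axis i 1)"
      by (simp add: K cinner_add_left cinner_add_right)
    finally have "cinner (?D *v ?u) ?u' = cinner (axis j 1) (axis i 1)"
      by (simp add: Delta_def matrix_vector_mult_diff_rdistrib cinner_diff_left scaleR_mult_vec
          cinner_scaleR_left)
    moreover have "cinner (?D *v ?u) ?u' = cinner ((cadj K ** ?D ** K) *v axis j 1) (axis i 1)"
      by (simp add: cinner_mult_left cadj_mult cadj_cadj matrix_vector_mul_assoc matrix_mul_assoc)
    moreover have "\<dots> = (cadj K ** ?D ** K) $ i $ j"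
      by (simp add: cinner_axis_right mult_axis_component)
    ultimately show ?thesis
      by (simp add: cinner_axis_right axis_component mat_def)
  qed
  then have "(cadj K ** ?D) ** K = mat 1"
    by (simp add: vec_eq_iff)
  \<comment> \<open>All matrices are square, so a left inverse is also a right inverse. This rotates
    the factors until \<open>K ** cadj K\<close> stands alone beside \<open>?D\<close>.\<close>
  then have inv: "invertible K" and "K ** (cadj K ** ?D) = mat 1"
    using invertible_left_inverse matrix_left_right_inverse by blast+
  then have DK: "?D ** (K ** cadj K) = mat 1"
    by (simp add: matrix_mul_assoc matrix_left_right_inverse)
  then have "invertible ?D" and "matrix_inv ?D = K ** cadj K"
    using invertible_right_inverse matrix_inv_unique by blast+
  with inv show "invertible (Gtf A Th B C (\<lambda>z. opBadj B (Q z)) ?s) \<and> invertible ?D \<and>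
      matrix_inv ?D = Gtf A Th B C (\<lambda>z. opBadj B (Q z)) ?s
        ** cadj (Gtf A Th B C (\<lambda>z. opBadj B (Q z)) ?s)"
    by (simp add: K_def L_def)
qed

end
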